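(* Let $\mathfrak g$ be a finite-dimensional real Lie algebra that admits a $\mathfrak g$-invariant (positive definite) inner product, let $\mathfrak h\subset\mathfrak g$ be a Lie subalgebra of even codimension, and let $J$ be an $\mathfrak h$-invariant integrable complex structure on $\mathfrak g/\mathfrak h$. Let $\pi:\mathfrak g_{\mathbb C}\to\mathfrak g_{\mathbb C}/\mathfrak h_{\mathbb C}=(\mathfrak g/\mathfrak h)_{\mathbb C}$ be the complex-linear extension of the natural surjection $\mathfrak g\to\mathfrak g/\mathfrak h$, extend $J$ complex-linearly to $(\mathfrak g/\mathfrak h)_{\mathbb C}$, and let $(\mathfrak g/\mathfrak h)_+$ be the $\mathbf i$-eigenspace of $J$ in $(\mathfrak g/\mathfrak h)_{\mathbb C}$. Let $$\mathfrak m=\{x\in N_{\mathfrak g}(\mathfrak h)\mid [\overline{ad}(x),J]=0\}.$$ Then the normalizer $\mathfrak p$ of $\pi^{-1}((\mathfrak g/\mathfrak h)_+)$ in $\mathfrak g_{\mathbb C}$ is a parabolic subalgebra of $\mathfrak g_{\mathbb C}$; as a real vector space $$\mathfrak p=\mathfrak u\oplus\pi^{-1}((\mathfrak g/\mathfrak h)_+),$$ where $\mathfrak u$ is any subalgebra of $\mathfrak g$ satisfying $\mathfrak u\oplus\mathfrak h=\mathfrak m$ (direct sum of vector spaces). Also $\mathfrak p\cap\mathfrak g=\mathfrak m$.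
   Context: $N_{\mathfrak g}(\mathfrak h)=\{x\in\mathfrak g\mid [x,\mathfrak h]\subset\mathfrak h\}$. For $x\in N_{\mathfrak g}(\mathfrak h)$, $\overline{ad}(x)$ is the endomorphism of $\mathfrak g/\mathfrak h$ induced by $ad(x)y=[x,y]$. An $\mathfrak h$-invariant complex structure on $\mathfrak g/\mathfrak h$ is a real-linear $J\in\mathrm{End}(\mathfrak g/\mathfrak h)$ with $J^2=-\mathrm{id}$ and $[J,\overline{ad}(x)]=0$ for all $x\in\mathfrak h$. It is integrable if $N=0$, where $N(u,v)=\pi[x,y]+J(\pi[x',y]+\pi[x,y'])-\pi[x',y']$ for any $x,y,x',y'\in\mathfrak g$ with $\pi(x)=u$, $\pi(y)=v$, $\pi(x')=Ju$, $\pi(y')=Jv$ (the value is independent of the choices). A parabolic subalgebra of $\mathfrak g_{\mathbb C}=\mathfrak g\otimes\mathbb C$ is a complex subalgebra containing a Borel (maximal solvable) subalgebra of $\mathfrak g_{\mathbb C}$. *)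

theory Defs
  imports "HOL-Analysis.Analysis"
begin

locale lie_algebra = vector_space scale
  for scale :: "'k::field \<Rightarrow> 'v::ab_group_add \<Rightarrow> 'v" +
  fixes bracket :: "'v \<Rightarrow> 'v \<Rightarrow> 'v"
  assumes linear_bracket_right: "Vector_Spaces.linear scale scale (\<lambda>y. bracket x y)"
    and linear_bracket_left: "Vector_Spaces.linear scale scale (\<lambda>x. bracket x y)"
    and bracket_self: "bracket x x = 0"
    and jacobi: "bracket x (bracket y z) + bracket y (bracket z x) + bracket z (bracket x y) = 0"
begin

definition lie_subalgebra :: "'v set \<Rightarrow> bool" where
  "lie_subalgebra S \<longleftrightarrow> subspace S \<and> (\<forall>x\<in>S. \<forall>y\<in>S. bracket x y \<in> S)"

definition normalizer :: "'v set \<Rightarrow> 'v set" where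
  "normalizer S = {x. \<forall>y\<in>S. bracket x y \<in> S}"

primrec derived_series :: "'v set \<Rightarrow> nat \<Rightarrow> 'v set" where
  "derived_series S 0 = S"
| "derived_series S (Suc n) =
     span {bracket x y | x y. x \<in> derived_series S n \<and> y \<in> derived_series S n}"

definition solvable_subalgebra :: "'v set \<Rightarrow> bool" where
  "solvable_subalgebra S \<longleftrightarrow> lie_subalgebra S \<and> (\<exists>n. derived_series S n = {0})"

definition borel_subalgebra :: "'v set \<Rightarrow> bool" where
  "borel_subalgebra S \<longleftrightarrow>
     solvable_subalgebra S \<and> (\<forall>T. solvable_subalgebra T \<and> S \<subseteq> T \<longrightarrow> T = S)"

definition parabolic_subalgebra :: "'v set \<Rightarrow> bool" where
  "parabolic_subalgebra P \<longleftrightarrow> lie_subalgebra P \<and> (\<exists>S. borel_subalgebra S \<and> S \<subseteq> P)"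

end

definition invariant_inner_product ::
  "('g::real_vector \<Rightarrow> 'g \<Rightarrow> 'g) \<Rightarrow> ('g \<Rightarrow> 'g \<Rightarrow> real) \<Rightarrow> bool" where
  "invariant_inner_product br B \<longleftrightarrow>
     bilinear B \<and> (\<forall>x y. B x y = B y x) \<and> (\<forall>x. x \<noteq> 0 \<longrightarrow> B x x > 0) \<and>
     (\<forall>x y z. B (br x y) z + B y (br x z) = 0)"

definition direct_sum :: "'v::real_vector set \<Rightarrow> 'v set \<Rightarrow> 'v set \<Rightarrow> bool" where
  "direct_sum U W V \<longleftrightarrow> subspace U \<and> subspace W \<and> U \<inter> W = {0} \<and> V = U + W"

text \<open>An element \<open>a + i b\<close> of a complexification is the pair \<open>(a, b)\<close>. The real scalar
  multiplication \<open>sc\<close> is a parameter because the construction is applied both to a type of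
  class \<open>real_vector\<close> and to a quotient space whose elements are cosets.\<close>

definition cscale :: "(real \<Rightarrow> 'v::plus \<Rightarrow> 'v) \<Rightarrow> complex \<Rightarrow> 'v \<times> 'v \<Rightarrow> 'v \<times> 'v" where
  "cscale sc c z = (sc (Re c) (fst z) + sc (- Im c) (snd z), sc (Re c) (snd z) + sc (Im c) (fst z))"

definition cbracket :: "('v::ab_group_add \<Rightarrow> 'v \<Rightarrow> 'v) \<Rightarrow> 'v \<times> 'v \<Rightarrow> 'v \<times> 'v \<Rightarrow> 'v \<times> 'v" where
  "cbracket br z w =
     (br (fst z) (fst w) - br (snd z) (snd w), br (fst z) (snd w) + br (snd z) (fst w))"

definition cembed :: "'v::zero \<Rightarrow> 'v \<times> 'v" where
  "cembed x = (x, 0)"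

lemma lie_algebra_complexification:
  fixes br :: "'g::real_vector \<Rightarrow> 'g \<Rightarrow> 'g"
  assumes "lie_algebra scaleR br"
  shows "lie_algebra (cscale scaleR) (cbracket br)"
proof -
  interpret lie_algebra scaleR br by fact
  have br: "br x (y + z) = br x y + br x z" "br (x + y) z = br x z + br y z"
     "br x (a *\<^sub>R y) = a *\<^sub>R br x y" "br (a *\<^sub>R x) y = a *\<^sub>R br x y" for x y z a
    using linear_bracket_right[of x] linear_bracket_left[of y] linear_bracket_left[of z]
    by (auto simp: Vector_Spaces.linear_def module_hom_def module_hom_axioms_def)
  have brm: "br x (- y) = - br x y" "br (- x) y = - br x y" for x y
    using br(3)[of x "-1" y] br(4)[of "-1" x y] by auto
  have brd: "br x (y - z) = br x y - br x z" "br (x - y) z = br x z - br y z" for x y z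
    using br(1)[of x y "-z"] br(2)[of x "-y" z] brm by auto
  have anti: "br x y = - br y x" for x y
  proof -
    have "br (x + y) (x + y) = (br x x + br y x) + (br x y + br y y)"
      by (simp only: br)
    then have "br x y + br y x = 0" by (simp add: bracket_self add.commute)
    then show ?thesis by (simp only: eq_neg_iff_add_eq_0)
  qed
  have vs: "vector_space (cscale scaleR :: complex \<Rightarrow> 'g \<times> 'g \<Rightarrow> 'g \<times> 'g)"
    by unfold_locales (auto simp: cscale_def prod_eq_iff algebra_simps scaleR_diff_left)
  then have md: "module (cscale scaleR :: complex \<Rightarrow> 'g \<times> 'g \<Rightarrow> 'g \<times> 'g)"
    by (simp add: vector_space_def module_def)
  define jac where "jac x y z = br x (br y z) + br y (br z x) + br z (br x y)" for x y z
  have jac0: "jac x y z = 0" for x y z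
    unfolding jac_def by (rule jacobi)
  show ?thesis
  proof (intro lie_algebra.intro vs lie_algebra_axioms.intro)
    fix x y z :: "'g \<times> 'g"
    show "Vector_Spaces.linear (cscale scaleR) (cscale scaleR) (cbracket br x)"
      by (intro Vector_Spaces.linear.intro vs module_hom.intro module_hom_axioms.intro md)
        (auto simp: cscale_def cbracket_def prod_eq_iff br brm brd algebra_simps)
    show "Vector_Spaces.linear (cscale scaleR) (cscale scaleR) (\<lambda>x. cbracket br x y)"
      by (intro Vector_Spaces.linear.intro vs module_hom.intro module_hom_axioms.intro md)
        (auto simp: cscale_def cbracket_def prod_eq_iff br brm brd algebra_simps)
    show "cbracket br x x = 0"
      using anti[of "fst x" "snd x"] by (simp add: cbracket_def prod_eq_iff bracket_self)
    obtain a b c d e f where xyz: "x = (a, b)" "y = (c, d)" "z = (e, f)"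
      by (metis surj_pair)
    have "cbracket br x (cbracket br y z) + cbracket br y (cbracket br z x)
        + cbracket br z (cbracket br x y)
      = (jac a c e - jac a d f - jac b c f - jac b d e,
         jac a c f + jac a d e + jac b c e - jac b d f)"
      by (simp add: xyz cbracket_def jac_def br brd algebra_simps)
    then show "cbracket br x (cbracket br y z) + cbracket br y (cbracket br z x)
        + cbracket br z (cbracket br x y) = 0"
      by (simp add: jac0 zero_prod_def)
  qed
qed

text \<open>The elements of the quotient are the cosets \<open>x +o h\<close>; they are added as subsets
  (\<open>+\<close> of \<open>Set_Algebras\<close>), and the zero element is \<open>h\<close>. Beware that \<open>- A\<close> on sets is the
  complement: the negative of a coset \<open>A\<close> is \<open>qscale h (- 1) A\<close>.\<close>

definition quot :: "'v::real_vector set \<Rightarrow> 'v set set" where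
  "quot h = range (\<lambda>x. x +o h)"

text \<open>Adding \<open>h\<close> matters only for the scalar \<open>0\<close>.\<close>

definition qscale :: "'v::real_vector set \<Rightarrow> real \<Rightarrow> 'v set \<Rightarrow> 'v set" where
  "qscale h c A = scaleR c ` A + h"

lemma qadd_coset:
  assumes "subspace h"
  shows "(x +o h) + (y +o h) = (x + y) +o h"
proof -
  have "h + h = h"
    using assms subspace_add[OF assms] subspace_0[OF assms]
    by (auto simp: set_plus_def) (metis add_0)
  then show ?thesis by (simp add: set_plus_rearrange)
qed

lemma qscale_coset:
  assumes "subspace h"
  shows "qscale h c (x +o h) = (c *\<^sub>R x) +o h"
proof (intro set_eqI iffI)
  fix z assume "z \<in> qscale h c (x +o h)"
  then obtain a b where "a \<in> h" "b \<in> h" "z = c *\<^sub>R (x + a) + b"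
    by (auto simp: qscale_def set_plus_def elt_set_plus_def)
  then have "z = c *\<^sub>R x + (c *\<^sub>R a + b)" "c *\<^sub>R a + b \<in> h"
    using assms by (auto simp: algebra_simps subspace_add subspace_scale)
  then show "z \<in> (c *\<^sub>R x) +o h" by (auto simp: elt_set_plus_def)
next
  fix z assume "z \<in> (c *\<^sub>R x) +o h"
  then obtain b where "b \<in> h" "z = c *\<^sub>R (x + 0) + b" "0 \<in> h"
    using assms by (auto simp: elt_set_plus_def subspace_0)
  then show "z \<in> qscale h c (x +o h)"
    by (force simp: qscale_def set_plus_def elt_set_plus_def)
qed

text \<open>Maps on the quotient are total functions on sets, of which only the values on \<open>quot h\<close>
  are relevant.\<close>

definition quot_endo :: "'v::real_vector set \<Rightarrow> ('v set \<Rightarrow> 'v set) \<Rightarrow> bool" where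
  "quot_endo h J \<longleftrightarrow>
     (\<forall>A\<in>quot h. J A \<in> quot h) \<and>
     (\<forall>A\<in>quot h. \<forall>B\<in>quot h. J (A + B) = J A + J B) \<and>
     (\<forall>c. \<forall>A\<in>quot h. J (qscale h c A) = qscale h c (J A))"

definition quot_ad :: "('v::real_vector \<Rightarrow> 'v \<Rightarrow> 'v) \<Rightarrow> 'v set \<Rightarrow> 'v \<Rightarrow> 'v set \<Rightarrow> 'v set" where
  "quot_ad br h x A = br x ` A + h"

lemma quot_ad_coset:
  assumes "lie_algebra scaleR br" "subspace h" "x \<in> lie_algebra.normalizer br h"
  shows "quot_ad br h x (y +o h) = br x y +o h"
proof -
  interpret lie_algebra scaleR br by fact
  have add: "br x (y + z) = br x y + br x z" for y z
    using linear_bracket_right[of x]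
    by (auto simp: Vector_Spaces.linear_def module_hom_def module_hom_axioms_def)
  have N: "br x a \<in> h" if "a \<in> h" for a
    using assms(3) that by (auto simp: normalizer_def)
  have br0: "br x 0 = 0" using add[of 0 0] by simp
  have 0: "0 \<in> h" using assms(2) by (rule subspace_0)
  show ?thesis
  proof (intro set_eqI iffI)
    fix z assume "z \<in> quot_ad br h x (y +o h)"
    then obtain a b where "a \<in> h" "b \<in> h" "z = br x y + (br x a + b)"
      by (auto simp: quot_ad_def set_plus_def elt_set_plus_def add add.assoc)
    then show "z \<in> br x y +o h"
      using N assms(2) by (auto simp: elt_set_plus_def subspace_add)
  next
    fix z assume "z \<in> br x y +o h"
    then obtain b where b: "b \<in> h" "z = br x (y + 0) + b" by (auto simp: elt_set_plus_def)
    then show "z \<in> quot_ad br h x (y +o h)"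
      using 0 unfolding quot_ad_def set_plus_def elt_set_plus_def by blast
  qed
qed

definition invariant_complex_structure ::
  "('v::real_vector \<Rightarrow> 'v \<Rightarrow> 'v) \<Rightarrow> 'v set \<Rightarrow> ('v set \<Rightarrow> 'v set) \<Rightarrow> bool" where
  "invariant_complex_structure br h J \<longleftrightarrow>
     quot_endo h J \<and>
     (\<forall>A\<in>quot h. J (J A) = qscale h (- 1) A) \<and>
     (\<forall>x\<in>h. \<forall>A\<in>quot h. J (quot_ad br h x A) = quot_ad br h x (J A))"

definition integrable_complex_structure ::
  "('v::real_vector \<Rightarrow> 'v \<Rightarrow> 'v) \<Rightarrow> 'v set \<Rightarrow> ('v set \<Rightarrow> 'v set) \<Rightarrow> bool" where
  "integrable_complex_structure br h J \<longleftrightarrow>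
     (\<forall>x y x' y'. x' +o h = J (x +o h) \<and> y' +o h = J (y +o h) \<longrightarrow>
        (br x y +o h) + J ((br x' y +o h) + (br x y' +o h)) + qscale h (- 1) (br x' y' +o h) = h)"

definition holomorphic_normalizer ::
  "('v::real_vector \<Rightarrow> 'v \<Rightarrow> 'v) \<Rightarrow> 'v set \<Rightarrow> ('v set \<Rightarrow> 'v set) \<Rightarrow> 'v set" where
  "holomorphic_normalizer br h J =
     {x \<in> lie_algebra.normalizer br h. \<forall>A\<in>quot h. quot_ad br h x (J A) = J (quot_ad br h x A)}"

text \<open>The complexification of the quotient has carrier \<open>quot h \<times> quot h\<close> and scalar
  multiplication \<open>cscale (qscale h)\<close>; complex-linear extensions act on both components.\<close>

definition cproj :: "'v::real_vector set \<Rightarrow> 'v \<times> 'v \<Rightarrow> 'v set \<times> 'v set" where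
  "cproj h = map_prod (\<lambda>x. x +o h) (\<lambda>x. x +o h)"

definition plus_eigenspace ::
  "'v::real_vector set \<Rightarrow> ('v set \<Rightarrow> 'v set) \<Rightarrow> ('v set \<times> 'v set) set" where
  "plus_eigenspace h J = {U \<in> quot h \<times> quot h. map_prod J J U = cscale (qscale h) \<i> U}"

end

theory Submission
  imports Defs "HOL-Computational_Algebra.Fundamental_Theorem_Algebra"
begin

text \<open>
  Write \<open>q\<close> for the preimage of the \<open>i\<close>-eigenspace, \<open>p\<close> for its normalizer in the
  complexification, and \<open>cj\<close> for complex conjugation with respect to the real form.

  Integrability of the complex structure says that \<open>q\<close> is a complex subalgebra, and every real
  vector is the real part of an element of \<open>q\<close>. The real elements of \<open>q\<close> are those of \<open>h\<close>, and a real
  element normalizes \<open>q\<close> if and only if it normalizes \<open>h\<close> and commutes with \<open>J\<close>, that is, lies in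
  \<open>m\<close>. Since any imaginary part can be removed by subtracting an element of \<open>q \<subseteq> p\<close>, one gets
  \<open>p = m + q\<close>, and then \<open>p = u \<oplus> q\<close> for every complement \<open>u\<close> of \<open>h\<close> in \<open>m\<close>
  (\<open>direct_sum_normalizer\<close>). Such a subalgebra \<open>u\<close> exists: \<open>h\<close> is an ideal of \<open>m\<close>, so its orthogonal
  complement in \<open>m\<close> is one too (\<open>orthogonal_ideal_complement\<close>).

  That \<open>p\<close> is parabolic is proved by a moment map. Extend the invariant inner product to a hermitian
  one, so that \<open>ad (cj z)\<close> is minus the adjoint of \<open>ad z\<close>, and let \<open>P\<close> be the orthogonal projection
  onto \<open>q\<close>. The linear functional \<open>z \<mapsto> tr (P ad z)\<close> equals \<open>z \<mapsto> i \<langle>z, \<xi>\<rangle>\<close> for a real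
  \<open>\<xi>\<close>; up to normalization \<open>\<xi>\<close> is the value at the point \<open>q\<close> of the moment map of the
  Grassmannian. For \<open>z \<in> p\<close> the number \<open>tr (P ad [cj z, z])\<close> is the squared Hilbert-Schmidt norm
  of \<open>(1 - P) ad (cj z) P\<close>. So it is nonnegative, and it vanishes only if \<open>cj z\<close> also normalizes
  \<open>q\<close>. Hence real elements that commute with \<open>\<xi>\<close> lie in \<open>p\<close>, in particular \<open>\<xi>\<close> itself, and the
  hermitian operator \<open>- i ad \<xi>\<close> has nonnegative eigenvalues on \<open>p\<close> and nonpositive ones on
  \<open>cj p\<close>. Because \<open>p + cj p\<close> is everything, \<open>p\<close> contains all eigenvectors of \<open>- i ad \<xi>\<close> with
  nonnegative eigenvalue (\<open>exists_upper_subset_normalizer\<close>).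

  A small perturbation of \<open>\<xi>\<close> inside its centralizer only shrinks the span of these eigenvectors;
  repeating it, one reaches a real \<open>\<zeta>\<close> whose centralizer is abelian (\<open>exists_regular_upper\<close>). The
  span \<open>s\<close> of the eigenvectors of \<open>- i ad \<zeta>\<close> with nonnegative eigenvalue is then a Borel subalgebra
  (\<open>borel_upper\<close>). It is solvable because eigenvalues add up under brackets and the centralizer is abelian. If \<open>T\<close> is a solvable
  subalgebra that contains \<open>s\<close>, then \<open>T\<close> is the sum of \<open>s\<close> and the real elements of \<open>T\<close>, as
  \<open>s + cj s\<close> is everything. But \<open>T \<inter> cj T\<close> is solvable and stable under conjugation, and positivity
  of the inner product forces such an algebra to be abelian
  (\<open>solvable_conjugation_stable_abelian\<close>). So the real elements of \<open>T\<close> commute with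
  \<open>\<zeta>\<close> and lie in \<open>s\<close>, which gives \<open>T = s\<close>.
\<close>

section \<open>Skew-hermitian operators on finite-dimensional spaces\<close>

context finite_dimensional_vector_space
begin

text \<open>Otherwise the first \<open>k\<close> vectors would be independent for every \<open>k\<close>.\<close>

lemma exists_in_span_of_predecessors:
  fixes w :: "nat \<Rightarrow> 'b"
  shows "\<exists>k. w k \<in> span (w ` {..<k})"
proof (rule ccontr)
  assume "\<nexists>k. w k \<in> span (w ` {..<k})"
  then have out: "w k \<notin> span (w ` {..<k})" for k by blast
  have indep: "independent (w ` {..<k}) \<and> card (w ` {..<k}) = k" for k
  proof (induction k)
    case 0
    then show ?case by (simp add: independent_empty)
  next
    case (Suc k)
    have "w k \<notin> w ` {..<k}" using out[of k] span_base[of "w k" "w ` {..<k}"] by argo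
    moreover have "w ` {..<Suc k} = insert (w k) (w ` {..<k})" by (simp add: lessThan_Suc)
    moreover have "independent (insert (w k) (w ` {..<k}))"
      using Suc out[of k] independent_insertI by blast
    ultimately show ?case using Suc by simp
  qed
  have "k \<le> dim UNIV" for k
    using independent_card_le_dim[of "w ` {..<k}" UNIV] indep[of k] by simp
  then show False using Suc_n_not_le_n by blast
qed

end

locale complex_vector_space = finite_dimensional_vector_space scale Basis
  for scale :: "complex \<Rightarrow> 'v::ab_group_add \<Rightarrow> 'v" (infixr "*c" 75) and Basis
begin

text \<open>The powers of \<open>A\<close> applied to \<open>v\<close> are linearly dependent, so some nonzero polynomial in \<open>A\<close> kills \<open>v\<close>.
If \<open>p\<close> has least degree among these and \<open>l\<close> is a root of \<open>p\<close>, then \<open>p / (X - l)\<close> sends \<open>v\<close> to an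
eigenvector.\<close>

lemma exists_eigenvector:
  assumes lin: "Vector_Spaces.linear scale scale A"
    and S: "subspace S" "A ` S \<subseteq> S" "v \<in> S" "v \<noteq> 0"
  shows "\<exists>l. \<exists>u\<in>S. u \<noteq> 0 \<and> A u = l *c u"
proof -
  have A_add: "A (x + y) = A x + A y" and A_scale: "A (c *c x) = c *c A x" for x y c
    using lin by (auto simp: Vector_Spaces.linear_iff)
  have A_0: "A 0 = 0" using A_add[of 0 0] by simp
  \<comment> \<open>\<open>p(A) v\<close> in Horner form, which gives the recursion \<open>ev_pCons\<close>\<close>
  define ev where "ev p = fold_coeffs (\<lambda>a w. a *c v + A w) p 0" for p
  have ev_0: "ev 0 = 0" by (simp add: ev_def)
  have ev_pCons: "ev (pCons a p) = a *c v + A (ev p)" for a p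
    by (cases "p = 0 \<and> a = 0") (auto simp: ev_def A_0)
  have ev_add: "ev (p + q) = ev p + ev q" for p q
  proof (induction p arbitrary: q)
    case 0
    then show ?case by (simp add: ev_0)
  next
    case (pCons a p)
    obtain b r where q: "q = pCons b r" by (cases q)
    show ?case unfolding q by (simp add: ev_pCons pCons.IH A_add algebra_simps)
  qed
  have ev_smult: "ev (smult c p) = c *c ev p" for c p
    by (induction p) (simp_all add: ev_0 ev_pCons A_scale scale_right_distrib)
  have ev_mem: "ev p \<in> S" for p
    using S by (induction p)
      (auto simp: ev_0 ev_pCons subspace_0 subspace_add subspace_scale image_subset_iff)
  have "\<exists>p. p \<noteq> 0 \<and> ev p = 0"
  proof -
    define w where "w k = ev (monom 1 k)" for k
    obtain k where k: "w k \<in> span (w ` {..<k})"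
      using exists_in_span_of_predecessors by blast
    have "span (w ` {..<k}) \<subseteq> {ev r | r. \<forall>i\<ge>k. coeff r i = 0}"
    proof (rule span_minimal)
      show "w ` {..<k} \<subseteq> {ev r | r. \<forall>i\<ge>k. coeff r i = 0}"
        by (auto simp: w_def)
      show "subspace {ev r | r. \<forall>i\<ge>k. coeff r i = 0}"
      proof (rule subspaceI)
        show "0 \<in> {ev r | r. \<forall>i\<ge>k. coeff r i = 0}"
          using ev_0 by (smt (verit) coeff_0 mem_Collect_eq)
        fix x y c
        assume x: "x \<in> {ev r | r. \<forall>i\<ge>k. coeff r i = 0}"
        then obtain r where r: "x = ev r" "\<forall>i\<ge>k. coeff r i = 0" by blast
        show "c *c x \<in> {ev r | r. \<forall>i\<ge>k. coeff r i = 0}"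
          using r by (auto intro!: exI[of _ "smult c r"] simp: ev_smult)
        assume "y \<in> {ev r | r. \<forall>i\<ge>k. coeff r i = 0}"
        then obtain t where t: "y = ev t" "\<forall>i\<ge>k. coeff t i = 0" by blast
        show "x + y \<in> {ev r | r. \<forall>i\<ge>k. coeff r i = 0}"
          using r t by (auto intro!: exI[of _ "r + t"] simp: ev_add)
      qed
    qed
    with k obtain r where r: "w k = ev r" "coeff r k = 0" by blast
    have "monom 1 k + smult (-1) r \<noteq> 0"
      using r(2) by (metis add.right_neutral coeff_0 coeff_add coeff_monom coeff_smult
          mult_zero_right zero_neq_one)
    moreover have "ev (monom 1 k + smult (-1) r) = 0"
      using r(1) by (simp add: ev_add ev_smult w_def del: smult_minus_left)
    ultimately show ?thesis by blast
  qed
  then obtain p where p: "p \<noteq> 0" "ev p = 0"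
    and min: "\<And>q. q \<noteq> 0 \<Longrightarrow> ev q = 0 \<Longrightarrow> degree p \<le> degree q"
    using ex_has_least_nat[of "\<lambda>p. p \<noteq> 0 \<and> ev p = 0" _ degree] by blast
  have "degree p \<noteq> 0"
  proof
    assume "degree p = 0"
    then obtain a where "p = [:a:]" by (rule degree_eq_zeroE)
    then show False using p S(4) by (simp add: ev_pCons ev_0 A_0)
  qed
  then obtain l where "poly p l = 0"
    using fundamental_theorem_of_algebra[of p] by (auto simp: constant_degree)
  then obtain r where r: "p = [:- l, 1:] * r"
    by (metis dvdE poly_eq_0_iff_dvd)
  have "r \<noteq> 0" using r p by auto
  then have "degree p = Suc (degree r)"
    unfolding r by (subst degree_mult_eq) auto
  then have "ev r \<noteq> 0" using min[OF \<open>r \<noteq> 0\<close>] by auto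
  moreover have "A (ev r) = l *c ev r"
  proof -
    have "p = smult (- l) r + pCons 0 r" unfolding r by simp
    then have "0 = (- l) *c ev r + A (ev r)"
      using p(2) by (simp add: ev_add ev_smult ev_pCons del: smult_minus_left)
    then show ?thesis by (simp add: algebra_simps)
  qed
  ultimately show ?thesis using ev_mem by blast
qed

end

locale hermitian_space = complex_vector_space scale Basis
  for scale :: "complex \<Rightarrow> 'v::ab_group_add \<Rightarrow> 'v" (infixr "*c" 75) and Basis +
  fixes ip :: "'v \<Rightarrow> 'v \<Rightarrow> complex"
  assumes ip_add_left: "ip (x + y) z = ip x z + ip y z"
    and ip_scale_left: "ip (c *c x) y = c * ip x y"
    and ip_commute: "ip y x = cnj (ip x y)"
    and ip_pos: "x \<noteq> 0 \<Longrightarrow> 0 < Re (ip x x)"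
begin

lemma ip_add_right: "ip x (y + z) = ip x y + ip x z"
  using ip_commute ip_add_left by (metis complex_cnj_add)

lemma ip_scale_right: "ip x (c *c y) = cnj c * ip x y"
  using ip_commute ip_scale_left by (metis complex_cnj_mult)

lemma ip_zero_left [simp]: "ip 0 x = 0"
  using ip_add_left[of 0 0 x] by simp

lemma ip_zero_right [simp]: "ip x 0 = 0"
  using ip_add_right[of x 0 0] by simp

lemma ip_minus_left: "ip (- x) y = - ip x y"
  using ip_add_left[of x "- x" y] by (simp add: eq_neg_iff_add_eq_0 add.commute)

lemma ip_minus_right: "ip x (- y) = - ip x y"
  using ip_add_right[of x y "- y"] by (simp add: eq_neg_iff_add_eq_0 add.commute)

lemma ip_diff_left: "ip (x - y) z = ip x z - ip y z"
  using ip_add_left[of x "- y" z] by (simp add: ip_minus_left)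

lemma ip_diff_right: "ip x (y - z) = ip x y - ip x z"
  using ip_add_right[of x y "- z"] by (simp add: ip_minus_right)

lemma ip_sum_left: "ip (sum f E) y = (\<Sum>e\<in>E. ip (f e) y)"
  by (induction E rule: infinite_finite_induct) (simp_all add: ip_add_left)

lemma ip_sum_right: "ip x (sum f E) = (\<Sum>e\<in>E. ip x (f e))"
  by (induction E rule: infinite_finite_induct) (simp_all add: ip_add_right)

lemmas ip_simps = ip_add_left ip_add_right ip_scale_left ip_scale_right
  ip_minus_left ip_minus_right ip_diff_left ip_diff_right ip_sum_left ip_sum_right

lemma ip_self: "ip x x = of_real (Re (ip x x))"
  using ip_commute[of x x] by (simp add: complex_eq_iff)

lemma ip_self_eq_0_iff [simp]: "ip x x = 0 \<longleftrightarrow> x = 0"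
  using ip_pos[of x] by force

lemma Re_ip_self_nonneg: "0 \<le> Re (ip x x)"
  using ip_pos[of x] by (cases "x = 0") auto

lemma ip_eq_0_commute: "ip x y = 0 \<longleftrightarrow> ip y x = 0"
  by (metis complex_cnj_zero ip_commute)

lemma orthogonal_span: "(\<And>y. y \<in> S \<Longrightarrow> ip x y = 0) \<Longrightarrow> y \<in> span S \<Longrightarrow> ip x y = 0"
  using span_minimal[of S "{y. ip x y = 0}"]
  by (auto simp: subspace_def ip_simps)

definition orthonormal :: "'v set \<Rightarrow> bool" where
  "orthonormal E \<longleftrightarrow> finite E \<and> (\<forall>e\<in>E. \<forall>f\<in>E. ip e f = (if e = f then 1 else 0))"

definition proj :: "'v set \<Rightarrow> 'v \<Rightarrow> 'v" where
  "proj E x = (\<Sum>e\<in>E. ip x e *c e)"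

lemma proj_in_span: "proj E x \<in> span E"
  unfolding proj_def by (intro span_sum span_scale span_base)

lemma ip_proj_left: "ip (proj E x) y = (\<Sum>f\<in>E. ip x f * ip f y)"
  by (simp add: proj_def ip_simps)

lemma ip_proj_basis:
  assumes "orthonormal E" "f \<in> E"
  shows "ip (proj E x) f = ip x f"
proof -
  have "ip (proj E x) f = (\<Sum>e\<in>E. if e = f then ip x e else 0)"
    unfolding proj_def ip_sum_left
    using assms by (intro sum.cong) (auto simp: orthonormal_def ip_simps)
  also have "\<dots> = ip x f"
    using assms by (simp add: orthonormal_def)
  finally show ?thesis .
qed

lemma ip_diff_proj: "orthonormal E \<Longrightarrow> y \<in> span E \<Longrightarrow> ip (x - proj E x) y = 0"
  by (rule orthogonal_span[of E]) (auto simp: ip_diff_left ip_proj_basis)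

lemma proj_eq:
  assumes "orthonormal E" "x \<in> span E"
  shows "proj E x = x"
proof -
  have "x - proj E x \<in> span E"
    using assms proj_in_span by (intro span_diff) auto
  then have "x - proj E x = 0"
    using ip_diff_proj[OF assms(1)] ip_self_eq_0_iff by blast
  then show ?thesis by simp
qed

lemma exists_orthonormal_span:
  assumes "finite S"
  shows "\<exists>E. orthonormal E \<and> span E = span S"
  using assms
proof induction
  case empty
  have "orthonormal {}" by (simp add: orthonormal_def)
  then show ?case by blast
next
  case (insert a S)
  then obtain E where E: "orthonormal E" "span E = span S" by blast
  define r where "r = a - proj E a"
  show ?case
  proof (cases "r = 0")
    case True
    then have "a \<in> span S" using proj_in_span[of E a] E(2) by (simp add: r_def)
    then show ?thesis using E by (metis span_redundant)
  next
    case False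
    define c where "c = complex_of_real (1 / sqrt (Re (ip r r)))"
    define e where "e = c *c r"
    have c: "c \<noteq> 0" using ip_pos[OF False] by (simp add: c_def)
    have "ip e e = (c * cnj c) * ip r r"
      by (simp add: e_def ip_simps)
    also have "\<dots> = 1"
      using ip_pos[OF False] by (subst ip_self) (simp add: c_def flip: of_real_mult)
    finally have ee: "ip e e = 1" .
    have ef: "ip e f = 0" if "f \<in> E" for f
      using ip_diff_proj[OF E(1) span_base[OF that]] by (simp add: e_def r_def ip_simps)
    then have fe: "ip f e = 0" if "f \<in> E" for f
      using that ip_eq_0_commute by blast
    have "orthonormal (insert e E)"
      using E(1) ee ef fe by (auto simp: orthonormal_def)
    moreover have "span (insert e E) = span (insert a S)"
    proof -
      have a: "a = proj E a + inverse c *c e"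
        using c by (simp add: e_def r_def)
      have "proj E a + inverse c *c e \<in> span (insert e E)"
        using proj_in_span[of E a] span_mono[of E "insert e E"]
        by (intro span_add span_scale) (auto intro: span_base)
      then have "a \<in> span (insert e E)" using a by simp
      moreover have "e \<in> span (insert a E)"
        using proj_in_span[of E a] span_mono[of E "insert a E"] unfolding e_def r_def
        by (intro span_scale span_diff) (auto intro: span_base)
      ultimately have "span (insert e E) = span (insert a E)"
        by (auto simp: span_eq intro: span_base)
      also have "\<dots> = span (insert a S)"
        using E(2) span_insert[of a E] span_insert[of a S] by simp
      finally show ?thesis .
    qed
    ultimately show ?thesis by blast
  qed
qed

lemma exists_orthonormal_basis:
  assumes "subspace S"
  obtains E where "orthonormal E" "span E = S"
  using assms exists_orthonormal_span basis_subspace_exists by metis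

lemma orthogonal_decomposition:
  assumes "subspace S"
  obtains y z where "x = y + z" "y \<in> S" "\<And>s. s \<in> S \<Longrightarrow> ip z s = 0"
proof -
  obtain E where E: "orthonormal E" "span E = S"
    using assms exists_orthonormal_basis by blast
  show thesis
    using that[of "proj E x" "x - proj E x"] ip_diff_proj[OF E(1)] proj_in_span[of E] E(2)
    by auto
qed

text \<open>For the skew-hermitian operators below these are the only eigenvalues that occur; \<open>l\<close> is the
eigenvalue of the hermitian operator \<open>- i A\<close>.\<close>

definition eigenspace :: "('v \<Rightarrow> 'v) \<Rightarrow> real \<Rightarrow> 'v set" where
  "eigenspace A l = {v. A v = (\<i> * of_real l) *c v}"

lemma subspace_eigenspace:
  assumes "Vector_Spaces.linear scale scale A"
  shows "subspace (eigenspace A l)"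
proof -
  have "A (x + y) = A x + A y" and "A (c *c x) = c *c A x" for x y c
    using assms by (auto simp: Vector_Spaces.linear_iff)
  moreover from this(1)[of 0 0] have "A 0 = 0" by simp
  ultimately show ?thesis
    by (intro subspaceI) (auto simp: eigenspace_def scale_right_distrib mult.commute)
qed

definition skew_hermitian :: "('v \<Rightarrow> 'v) \<Rightarrow> bool" where
  "skew_hermitian A \<longleftrightarrow>
     Vector_Spaces.linear scale scale A \<and> (\<forall>x y. ip (A x) y = - ip x (A y))"

lemma eigenspaces_orthogonal:
  assumes A: "skew_hermitian A"
    and v: "v \<in> eigenspace A l" and w: "w \<in> eigenspace A k" and "l \<noteq> k"
  shows "ip v w = 0"
proof -
  have "ip (A v) w = - ip v (A w)" using A by (simp add: skew_hermitian_def)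
  then have "(of_real l - of_real k) * ip v w = 0"
    using v w by (simp add: eigenspace_def ip_simps algebra_simps)
  then show ?thesis using \<open>l \<noteq> k\<close> by (simp flip: of_real_diff)
qed

text \<open>The orthogonal complement, within \<open>S\<close>, of the span of the eigenvectors is again invariant. If it
were nonzero, it would contain an eigenvector, orthogonal to itself.\<close>

lemma invariant_subspace_span_eigenvectors:
  assumes A: "skew_hermitian A" and S: "subspace S" "A ` S \<subseteq> S"
  shows "S \<subseteq> span (\<Union>l. eigenspace A l \<inter> S)"
proof -
  define W where "W = span (\<Union>l. eigenspace A l \<inter> S)"
  define U where "U = {x \<in> S. \<forall>y\<in>W. ip x y = 0}"
  have lin: "Vector_Spaces.linear scale scale A" and skew: "ip (A x) y = - ip x (A y)" for x y
    using A by (auto simp: skew_hermitian_def)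
  have A_add: "A (x + y) = A x + A y" and A_scale: "A (c *c x) = c *c A x" for x y c
    using lin by (auto simp: Vector_Spaces.linear_iff)
  have A_0: "A 0 = 0" using A_add[of 0 0] by simp
  have W: "subspace W" "W \<subseteq> S"
    unfolding W_def using S(1) by (simp, intro span_minimal) auto
  have AW: "A y \<in> W" if "y \<in> W" for y
  proof -
    have "span (\<Union>l. eigenspace A l \<inter> S) \<subseteq> {y. A y \<in> W}"
    proof (rule span_minimal)
      show "subspace {y. A y \<in> W}"
        using W(1) by (auto simp: subspace_def A_0 A_add A_scale)
      show "(\<Union>l. eigenspace A l \<inter> S) \<subseteq> {y. A y \<in> W}"
      proof clarify
        fix l v assume v: "v \<in> eigenspace A l" "v \<in> S"
        then have "v \<in> W" unfolding W_def by (auto intro: span_base)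
        then show "A v \<in> W" using v W(1) by (simp add: eigenspace_def subspace_scale)
      qed
    qed
    then show ?thesis using that W_def by auto
  qed
  have U: "subspace U"
    unfolding U_def using S(1) by (auto simp: subspace_def ip_simps)
  have AU: "A ` U \<subseteq> U"
    using S(2) AW by (auto simp: U_def skew)
  have "U \<subseteq> {0}"
  proof (rule ccontr)
    assume "\<not> U \<subseteq> {0}"
    then obtain v where "v \<in> U" "v \<noteq> 0" by blast
    then obtain l u where u: "u \<in> U" "u \<noteq> 0" "A u = l *c u"
      using exists_eigenvector[OF lin U AU] by blast
    have "l * ip u u = - cnj l * ip u u"
      using skew[of u u] u(3) by (simp add: ip_simps)
    then have "(l + cnj l) * ip u u = 0" by (simp add: distrib_right)
    then have "l = - cnj l" using u(2) by (simp add: eq_neg_iff_add_eq_0)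
    then have "l = \<i> * of_real (Im l)" by (simp add: complex_eq_iff)
    then have "u \<in> eigenspace A (Im l)" using u(3) by (simp add: eigenspace_def)
    then have "u \<in> W" using u(1) unfolding W_def U_def by (auto intro: span_base)
    then show False using u by (auto simp: U_def)
  qed
  show ?thesis
  proof
    fix x assume "x \<in> S"
    obtain y z where yz: "x = y + z" "y \<in> W" "\<And>s. s \<in> W \<Longrightarrow> ip z s = 0"
      using orthogonal_decomposition[OF W(1)] by blast
    have "z \<in> S" using yz(1,2) W(2) S(1) \<open>x \<in> S\<close> subspace_diff[of S x y] by auto
    then have "z \<in> U" using yz(3) by (simp add: U_def)
    then show "x \<in> span (\<Union>l. eigenspace A l \<inter> S)"
      using \<open>U \<subseteq> {0}\<close> yz by (auto simp: W_def)
  qed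
qed

text \<open>An eigenvector is not orthogonal to every member of a basis of eigenvectors, so its eigenvalue is
the eigenvalue of some basis vector.\<close>

lemma finite_spectrum:
  assumes A: "skew_hermitian A"
  shows "finite {l. eigenspace A l \<noteq> {0}}"
proof -
  have lin: "Vector_Spaces.linear scale scale A" using A by (simp add: skew_hermitian_def)
  obtain b where b: "b \<subseteq> (\<Union>l. eigenspace A l)" "independent b"
      "(\<Union>l. eigenspace A l) \<subseteq> span b"
    using basis_exists by metis
  have "UNIV \<subseteq> span (\<Union>l. eigenspace A l)"
    using invariant_subspace_span_eigenvectors[OF A, of UNIV] by simp
  also have "\<dots> \<subseteq> span b" by (rule span_minimal[OF b(3) subspace_span])
  finally have full: "span b = UNIV" by blast
  obtain ev where ev: "v \<in> eigenspace A (ev v)" if "v \<in> b" for v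
    using b(1) by (metis UN_E subsetD)
  have "{l. eigenspace A l \<noteq> {0}} \<subseteq> ev ` b"
  proof
    fix l assume "l \<in> {l. eigenspace A l \<noteq> {0}}"
    then obtain v where v: "v \<in> eigenspace A l" "v \<noteq> 0"
      using subspace_0[OF subspace_eigenspace[OF lin]] by blast
    then obtain w where "w \<in> b" "ip v w \<noteq> 0"
      using orthogonal_span[of b v v] full by auto
    then show "l \<in> ev ` b"
      using eigenspaces_orthogonal[OF A v(1) ev] by (metis imageI)
  qed
  then show ?thesis using finiteI_independent[OF b(2)] finite_subset by blast
qed

text \<open>The difference \<open>A z - i l z\<close> lies in \<open>S\<close>, because \<open>A y - i l y\<close> does, and is orthogonal to \<open>S\<close>, because
the orthogonal complement of \<open>S\<close> is invariant as well.\<close>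

lemma eigenvector_components:
  assumes A: "skew_hermitian A" and S: "subspace S" "A ` S \<subseteq> S"
    and v: "y + z \<in> eigenspace A l" and y: "y \<in> S" and z: "\<And>s. s \<in> S \<Longrightarrow> ip z s = 0"
  shows "y \<in> eigenspace A l" and "z \<in> eigenspace A l"
proof -
  have A_add: "A (a + b) = A a + A b" and skew: "ip (A a) b = - ip a (A b)" for a b
    using A by (auto simp: skew_hermitian_def Vector_Spaces.linear_iff)
  define w where "w = A z - (\<i> * of_real l) *c z"
  have w: "w = - (A y - (\<i> * of_real l) *c y)"
    using v by (simp add: w_def eigenspace_def A_add algebra_simps)
  have "A y \<in> S" using S(2) y by blast
  then have "w \<in> S" using w y S(1) by (simp only: subspace_diff subspace_scale subspace_neg)
  moreover have "ip w s = 0" if "s \<in> S" for s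
    using z[OF that] z[of "A s"] S(2) that by (simp add: w_def ip_simps skew image_subset_iff)
  ultimately have "w = 0" using ip_self_eq_0_iff by blast
  then show "y \<in> eigenspace A l" "z \<in> eigenspace A l"
    using w by (simp_all add: w_def eigenspace_def)
qed

end

section \<open>Lie algebras\<close>

context lie_algebra
begin

lemma bracket_add_left: "bracket (x + y) z = bracket x z + bracket y z"
  and bracket_scale_left: "bracket (scale c x) y = scale c (bracket x y)"
  using linear_bracket_left by (auto simp: Vector_Spaces.linear_iff)

lemma bracket_add_right: "bracket x (y + z) = bracket x y + bracket x z"
  and bracket_scale_right: "bracket x (scale c y) = scale c (bracket x y)"
  using linear_bracket_right by (auto simp: Vector_Spaces.linear_iff)

lemma bracket_zero_left [simp]: "bracket 0 x = 0"
  using bracket_add_left[of 0 0 x] by simp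

lemma bracket_zero_right [simp]: "bracket x 0 = 0"
  using bracket_add_right[of x 0 0] by simp

lemma bracket_minus_left: "bracket (- x) y = - bracket x y"
  using bracket_add_left[of x "- x" y] by (simp add: eq_neg_iff_add_eq_0 add.commute)

lemma bracket_minus_right: "bracket x (- y) = - bracket x y"
  using bracket_add_right[of x y "- y"] by (simp add: eq_neg_iff_add_eq_0 add.commute)

lemma bracket_diff_left: "bracket (x - y) z = bracket x z - bracket y z"
  using bracket_add_left[of x "- y" z] by (simp add: bracket_minus_left)

lemma bracket_diff_right: "bracket x (y - z) = bracket x y - bracket x z"
  using bracket_add_right[of x y "- z"] by (simp add: bracket_minus_right)

lemmas bracket_simps = bracket_add_left bracket_add_right bracket_scale_left bracket_scale_right
  bracket_minus_left bracket_minus_right bracket_diff_left bracket_diff_right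

lemma bracket_anticommute: "bracket y x = - bracket x y"
proof -
  have "bracket (x + y) (x + y) = bracket x x + bracket y x + (bracket x y + bracket y y)"
    by (simp only: bracket_simps)
  then have "bracket y x + bracket x y = 0" by (simp add: bracket_self add.commute)
  then show ?thesis by (simp only: eq_neg_iff_add_eq_0)
qed

text \<open>The Jacobi identity in the form that \<open>ad x\<close> is a derivation.\<close>

lemma bracket_derivation: "bracket x (bracket y z) = bracket (bracket x y) z + bracket y (bracket x z)"
proof -
  have "bracket y (bracket z x) = - bracket y (bracket x z)"
    by (subst bracket_anticommute[of x z]) (simp add: bracket_minus_right)
  moreover have "bracket z (bracket x y) = - bracket (bracket x y) z"
    by (rule bracket_anticommute)
  ultimately show ?thesis using jacobi[of x y z] by (simp add: algebra_simps)
qed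

lemma lie_subalgebra_normalizer:
  assumes "subspace S"
  shows "lie_subalgebra (normalizer S)"
proof -
  have "bracket (bracket x y) z \<in> S"
    if "x \<in> normalizer S" "y \<in> normalizer S" "z \<in> S" for x y z
  proof -
    have "bracket (bracket x y) z = bracket x (bracket y z) - bracket y (bracket x z)"
      using bracket_derivation[of x y z] by simp
    then show ?thesis using that assms by (simp add: normalizer_def subspace_diff)
  qed
  then show ?thesis
    using assms unfolding lie_subalgebra_def subspace_def normalizer_def
    by (simp add: bracket_simps)
qed

lemma span_bracket_subset:
  assumes "subspace S" "\<And>x y. x \<in> A \<Longrightarrow> y \<in> B \<Longrightarrow> bracket x y \<in> S" "x \<in> span A" "y \<in> span B"
  shows "bracket x y \<in> S"
proof -
  have "span B \<subseteq> {y. bracket a y \<in> S}" if "a \<in> A" for a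
    using assms(1,2) that by (intro span_minimal) (auto simp: subspace_def bracket_simps)
  then have "span A \<subseteq> {x. bracket x y \<in> S}"
    using assms(1,4) by (intro span_minimal) (auto simp: subspace_def bracket_simps)
  then show ?thesis using assms(3) by auto
qed

lemma subspace_derived_series: "subspace S \<Longrightarrow> subspace (derived_series S n)"
  by (cases n) auto

lemma derived_series_mono: "S \<subseteq> T \<Longrightarrow> derived_series S n \<subseteq> derived_series T n"
proof (induction n)
  case (Suc n)
  then have "{bracket x y | x y. x \<in> derived_series S n \<and> y \<in> derived_series S n}
      \<subseteq> {bracket x y | x y. x \<in> derived_series T n \<and> y \<in> derived_series T n}"
    by blast
  then show ?case by (simp add: span_mono)
qed simp

lemma bracket_in_derived_series_Suc:
  "x \<in> derived_series S n \<Longrightarrow> y \<in> derived_series S n \<Longrightarrow> bracket x y \<in> derived_series S (Suc n)"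
  by (auto intro: span_base)

lemma derived_series_Suc_subset:
  assumes "subspace T" "\<And>x y. x \<in> derived_series S n \<Longrightarrow> y \<in> derived_series S n \<Longrightarrow> bracket x y \<in> T"
  shows "derived_series S (Suc n) \<subseteq> T"
  unfolding derived_series.simps using assms by (intro span_minimal) auto

end

section \<open>Complex Lie algebras with a compact real form\<close>

text \<open>The elements fixed by \<open>cj\<close> are the real form. The last assumption is invariance of the inner
product, in the form that \<open>ad z\<close> and \<open>- ad (cj z)\<close> are adjoint to each other; in particular real
elements act by skew-hermitian operators.\<close>

locale compact_real_form = hermitian_space scale Basis ip + lie_algebra scale bracket
  for scale :: "complex \<Rightarrow> 'v::ab_group_add \<Rightarrow> 'v" (infixr "*c" 75) and Basis ip
    and bracket :: "'v \<Rightarrow> 'v \<Rightarrow> 'v" +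
  fixes cj :: "'v \<Rightarrow> 'v"
  assumes cj_cj [simp]: "cj (cj x) = x"
    and cj_add: "cj (x + y) = cj x + cj y"
    and cj_scale: "cj (c *c x) = cnj c *c cj x"
    and cj_bracket: "cj (bracket x y) = bracket (cj x) (cj y)"
    and ip_cj: "ip (cj x) (cj y) = cnj (ip x y)"
    and bracket_adjoint: "ip (bracket z x) y = - ip x (bracket (cj z) y)"
begin

lemma cj_zero [simp]: "cj 0 = 0"
  using cj_add[of 0 0] by simp

lemma cj_minus: "cj (- x) = - cj x"
  using cj_add[of x "- x"] by (simp add: eq_neg_iff_add_eq_0 add.commute)

lemma cj_diff: "cj (x - y) = cj x - cj y"
  using cj_add[of x "- y"] by (simp add: cj_minus)

lemma subspace_cj_image:
  assumes "subspace S"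
  shows "subspace {x. cj x \<in> S}"
  using assms by (auto simp: subspace_def cj_add cj_scale)

text \<open>A subspace that is stable under conjugation contains the real and imaginary parts of its elements, so
it is spanned by its real elements.\<close>

lemma subset_if_real_points_subset:
  assumes W: "subspace W" "\<And>x. x \<in> W \<Longrightarrow> cj x \<in> W" and S: "subspace S"
    and real: "\<And>x. x \<in> W \<Longrightarrow> cj x = x \<Longrightarrow> x \<in> S"
  shows "W \<subseteq> S"
proof
  fix x assume x: "x \<in> W"
  have "cj (x + cj x) = x + cj x" by (simp add: cj_add add.commute)
  moreover have "x + cj x \<in> W" using W x by (simp only: subspace_add)
  moreover have "cj (\<i> *c (x - cj x)) = \<i> *c (x - cj x)"
    by (simp add: cj_scale cj_diff algebra_simps)
  moreover have "\<i> *c (x - cj x) \<in> W" using W x by (simp only: subspace_diff subspace_scale)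
  ultimately have "x + cj x \<in> S" and "\<i> *c (x - cj x) \<in> S"
    using real by blast+
  then have "(1/2) *c ((x + cj x) - \<i> *c (\<i> *c (x - cj x))) \<in> S"
    using S by (simp only: subspace_scale subspace_diff)
  also have "(x + cj x) - \<i> *c (\<i> *c (x - cj x)) = (1 + 1) *c x"
    unfolding scale_left_distrib by (simp add: algebra_simps)
  finally show "x \<in> S" by simp
qed

lemma skew_hermitian_ad: "cj x = x \<Longrightarrow> skew_hermitian (bracket x)"
  by (simp add: skew_hermitian_def linear_bracket_right bracket_adjoint)

lemma bracket_eigenspaces:
  assumes "v \<in> eigenspace (bracket x) a" "w \<in> eigenspace (bracket x) b"
  shows "bracket v w \<in> eigenspace (bracket x) (a + b)"
  using assms by (simp add: eigenspace_def bracket_derivation[of x v w] bracket_simps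
      algebra_simps)

lemma cj_eigenspace:
  assumes "cj x = x" "v \<in> eigenspace (bracket x) a"
  shows "cj v \<in> eigenspace (bracket x) (- a)"
proof -
  have "bracket x (cj v) = cj (bracket x v)" using assms(1) by (simp add: cj_bracket)
  then show ?thesis using assms(2) by (simp add: eigenspace_def cj_scale)
qed

section \<open>Solvable subalgebras and eigenvectors of real elements\<close>

text \<open>All members of the derived series are stable under conjugation, and \<open>[cj a, [a, b]] = 0\<close> implies
\<open>\<parallel>[a, b]\<parallel>\<^sup>2 = - \<langle>b, [cj a, [a, b]]\<rangle> = 0\<close>. If the derived series vanishes from
step \<open>k + 2\<close> on, then step \<open>k + 1\<close> is abelian. Two uses of the criterion show first that it commutes
with step \<open>k\<close> and then that it vanishes. Descending on \<open>k\<close>, the derived algebra is zero.\<close>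

lemma solvable_conjugation_stable_abelian:
  assumes S: "subspace S" "\<And>x. x \<in> S \<Longrightarrow> cj x \<in> S" "\<And>x y. x \<in> S \<Longrightarrow> y \<in> S \<Longrightarrow> bracket x y \<in> S"
    and "derived_series S n = {0}" and xy: "x \<in> S" "y \<in> S"
  shows "bracket x y = 0"
proof -
  have sub: "subspace (derived_series S k)" for k
    using S(1) by (rule subspace_derived_series)
  have cj: "cj z \<in> derived_series S k" if "z \<in> derived_series S k" for z k
    using that
  proof (induction k arbitrary: z)
    case (Suc k)
    have "derived_series S (Suc k) \<subseteq> {z. cj z \<in> derived_series S (Suc k)}"
    proof (rule derived_series_Suc_subset)
      show "subspace {z. cj z \<in> derived_series S (Suc k)}"
        using subspace_cj_image[OF sub] .
      fix a b assume "a \<in> derived_series S k" "b \<in> derived_series S k"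
      then show "bracket a b \<in> {z. cj z \<in> derived_series S (Suc k)}"
        using bracket_in_derived_series_Suc[OF Suc.IH Suc.IH, of a b] by (simp only: cj_bracket mem_Collect_eq)
    qed
    then show ?case using Suc.prems by blast
  qed (use S(2) in simp)
  have dec: "derived_series S (Suc k) \<subseteq> derived_series S k" for k
  proof (induction k)
    case 0
    then show ?case using S by (intro derived_series_Suc_subset) auto
  next
    case (Suc k)
    then show ?case
      by (intro derived_series_Suc_subset[OF sub] bracket_in_derived_series_Suc) auto
  qed
  have norm0: "bracket a b = 0" if "bracket (cj a) (bracket a b) = 0" for a b
    using bracket_adjoint[of a b "bracket a b"] that by simp
  have step: "derived_series S (Suc k) \<subseteq> {0}" if D: "derived_series S (Suc (Suc k)) \<subseteq> {0}" for k
  proof -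
    have EE: "bracket a b = 0" if "a \<in> derived_series S (Suc k)" "b \<in> derived_series S (Suc k)" for a b
      using bracket_in_derived_series_Suc[OF that] D by blast
    have ED: "bracket a b = 0" if "a \<in> derived_series S (Suc k)" "b \<in> derived_series S k" for a b
    proof (rule norm0)
      have "a \<in> derived_series S k" using that(1) dec by blast
      then have "bracket a b \<in> derived_series S (Suc k)"
        using that(2) by (rule bracket_in_derived_series_Suc)
      then show "bracket (cj a) (bracket a b) = 0" using EE cj[OF that(1)] by blast
    qed
    show ?thesis
    proof (rule derived_series_Suc_subset)
      fix a b assume ab: "a \<in> derived_series S k" "b \<in> derived_series S k"
      have "bracket (bracket a b) (cj a) = 0"
        using ED[OF bracket_in_derived_series_Suc[OF ab] cj[OF ab(1)]] .
      then have "bracket (cj a) (bracket a b) = 0" using bracket_anticommute by (metis neg_equal_0_iff_equal)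
      then show "bracket a b \<in> {0}" using norm0 by blast
    qed simp
  qed
  have "derived_series S (Suc n) \<subseteq> {0}" using dec[of n] assms(4) by simp
  moreover have "derived_series S (Suc k) \<subseteq> {0} \<Longrightarrow> derived_series S (Suc 0) \<subseteq> {0}" for k
    by (induction k) (use step in blast)+
  ultimately have "derived_series S (Suc 0) \<subseteq> {0}" by blast
  then show ?thesis using bracket_in_derived_series_Suc[of x S 0 y] xy by auto
qed

text \<open>For real \<open>x\<close> and \<open>c = 0\<close> this is the parabolic subalgebra defined by \<open>x\<close>.\<close>

definition upper :: "'v \<Rightarrow> real \<Rightarrow> 'v set" where
  "upper x c = span (\<Union>l\<in>{c..}. eigenspace (bracket x) l)"

lemma subspace_upper: "subspace (upper x c)"
  by (simp add: upper_def)

lemma eigenspace_subset_upper: "c \<le> l \<Longrightarrow> eigenspace (bracket x) l \<subseteq> upper x c"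
  unfolding upper_def by (auto intro: span_base)

lemma bracket_upper: "v \<in> upper x a \<Longrightarrow> w \<in> upper x b \<Longrightarrow> bracket v w \<in> upper x (a + b)"
  unfolding upper_def[of x a] upper_def[of x b]
proof (rule span_bracket_subset[OF subspace_upper])
  fix v w
  assume "v \<in> (\<Union>l\<in>{a..}. eigenspace (bracket x) l)" "w \<in> (\<Union>l\<in>{b..}. eigenspace (bracket x) l)"
  then obtain l k where "a \<le> l" "v \<in> eigenspace (bracket x) l" "b \<le> k" "w \<in> eigenspace (bracket x) k"
    by auto
  then show "bracket v w \<in> upper x (a + b)"
    using eigenspace_subset_upper[of "a + b" "l + k"] bracket_eigenspaces by (meson add_mono subsetD)
qed

lemma upper_antimono: "a \<le> b \<Longrightarrow> upper x b \<subseteq> upper x a"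
  unfolding upper_def by (intro span_mono UN_mono) auto

text \<open>Eigenvectors with negative eigenvalue are conjugates of eigenvectors with positive eigenvalue.\<close>

lemma upper_plus_conjugate:
  assumes x: "cj x = x"
  obtains a b where "a \<in> upper x 0" "b \<in> upper x 0" "v = a + cj b"
proof -
  have "v \<in> {a + b | a b. a \<in> upper x 0 \<and> b \<in> {b. cj b \<in> upper x 0}}"
  proof -
    have "span (\<Union>l. eigenspace (bracket x) l)
        \<subseteq> {a + b | a b. a \<in> upper x 0 \<and> b \<in> {b. cj b \<in> upper x 0}}"
    proof (rule span_minimal)
      show "subspace {a + b | a b. a \<in> upper x 0 \<and> b \<in> {b. cj b \<in> upper x 0}}"
        by (intro subspace_sums subspace_upper subspace_cj_image)
      show "(\<Union>l. eigenspace (bracket x) l)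
          \<subseteq> {a + b | a b. a \<in> upper x 0 \<and> b \<in> {b. cj b \<in> upper x 0}}"
      proof clarify
        fix l v assume v: "v \<in> eigenspace (bracket x) l"
        have 0: "0 \<in> upper x 0" using subspace_upper subspace_0 by blast
        show "\<exists>a b. v = a + b \<and> a \<in> upper x 0 \<and> b \<in> {b. cj b \<in> upper x 0}"
        proof (cases "0 \<le> l")
          case True
          then have "v \<in> upper x 0" using v eigenspace_subset_upper by blast
          then show ?thesis using 0 by (intro exI[of _ v] exI[of _ 0]) simp
        next
          case False
          then have "cj v \<in> upper x 0"
            using cj_eigenspace[OF x v] eigenspace_subset_upper[of 0 "- l"] by auto
          then show ?thesis using 0 by (intro exI[of _ 0] exI[of _ v]) simp
        qed
      qed
    qed
    moreover have "UNIV \<subseteq> span (\<Union>l. eigenspace (bracket x) l)"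
      using invariant_subspace_span_eigenvectors[OF skew_hermitian_ad[OF x], of UNIV] by simp
    ultimately show ?thesis by blast
  qed
  then obtain a b where "v = a + b" "a \<in> upper x 0" "cj b \<in> upper x 0" by blast
  then show thesis using that[of a "cj b"] by simp
qed

lemma upper_eventually_zero:
  assumes "cj x = x"
  shows "\<exists>c. \<forall>d\<ge>c. upper x d = {0}"
proof -
  let ?L = "{l. eigenspace (bracket x) l \<noteq> {0}}"
  have fin: "finite ?L" using finite_spectrum skew_hermitian_ad assms by blast
  define c where "c = Max (insert 0 ?L) + 1"
  have "upper x d = {0}" if "c \<le> d" for d
  proof -
    have "eigenspace (bracket x) l = {0}" if "d \<le> l" for l
    proof (rule ccontr)
      assume "eigenspace (bracket x) l \<noteq> {0}"
      then have "l \<le> Max (insert 0 ?L)" using fin by (intro Max_ge) auto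
      then show False using that \<open>c \<le> d\<close> by (simp add: c_def)
    qed
    then have "(\<Union>l\<in>{d..}. eigenspace (bracket x) l) \<subseteq> {0}" by auto
    then have "upper x d \<subseteq> {0}" unfolding upper_def by (rule span_minimal) (rule subspace_single_0)
    then show ?thesis using subspace_0[OF subspace_upper] by blast
  qed
  then show ?thesis by blast
qed

lemma positive_spectral_gap:
  assumes "cj x = x"
  obtains d where "d > 0" "\<And>l. l > 0 \<Longrightarrow> l < d \<Longrightarrow> eigenspace (bracket x) l = {0}"
proof -
  let ?L = "{l. eigenspace (bracket x) l \<noteq> {0}} \<inter> {0<..}"
  have fin: "finite ?L" using finite_spectrum skew_hermitian_ad assms by blast
  show thesis
  proof (rule that[of "Min (insert 1 ?L)"])
    show "0 < Min (insert 1 ?L)" using fin by (subst Min_gr_iff) auto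
    fix l :: real assume l: "l > 0" "l < Min (insert 1 ?L)"
    show "eigenspace (bracket x) l = {0}"
    proof (rule ccontr)
      assume "eigenspace (bracket x) l \<noteq> {0}"
      then have "Min (insert 1 ?L) \<le> l" using fin l(1) by (intro Min_le) auto
      then show False using l(2) by simp
    qed
  qed
qed

text \<open>With \<open>d\<close> a lower bound for the positive eigenvalues, the derived algebra lies in \<open>upper x d\<close>,
as brackets of centralizer elements vanish. Each further step raises the bound by at least \<open>d\<close>,
and only finitely many eigenvalues are available.\<close>

lemma solvable_upper:
  assumes x: "cj x = x"
    and abelian: "\<And>v w. v \<in> eigenspace (bracket x) 0 \<Longrightarrow> w \<in> eigenspace (bracket x) 0 \<Longrightarrow> bracket v w = 0"
  shows "solvable_subalgebra (upper x 0)"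
proof -
  obtain d where d: "d > 0" "\<And>l. l > 0 \<Longrightarrow> l < d \<Longrightarrow> eigenspace (bracket x) l = {0}"
    using positive_spectral_gap[OF x] by blast
  obtain c where c: "\<And>k. k \<ge> c \<Longrightarrow> upper x k = {0}"
    using upper_eventually_zero[OF x] by blast
  have ds: "derived_series (upper x 0) (Suc n) \<subseteq> upper x (real (Suc n) * d)" for n
  proof (induction n)
    case 0
    have "bracket v w \<in> upper x d" if "v \<in> upper x 0" "w \<in> upper x 0" for v w
    proof (rule span_bracket_subset[OF subspace_upper _ that[unfolded upper_def]])
      fix v w
      assume "v \<in> (\<Union>l\<in>{0..}. eigenspace (bracket x) l)" "w \<in> (\<Union>l\<in>{0..}. eigenspace (bracket x) l)"
      then obtain l k where lk: "0 \<le> l" "v \<in> eigenspace (bracket x) l" "0 \<le> k" "w \<in> eigenspace (bracket x) k"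
        by auto
      have br: "bracket v w \<in> eigenspace (bracket x) (l + k)" using bracket_eigenspaces lk by blast
      consider "l + k = 0" | "0 < l + k" "l + k < d" | "d \<le> l + k" using lk by linarith
      then show "bracket v w \<in> upper x d"
      proof cases
        case 1
        then have "bracket v w = 0" using abelian lk by (simp add: add_nonneg_eq_0_iff)
        then show ?thesis by (simp add: subspace_0 subspace_upper)
      next
        case 2
        then have "bracket v w = 0" using br d by blast
        then show ?thesis by (simp add: subspace_0 subspace_upper)
      next
        case 3
        then show ?thesis using br eigenspace_subset_upper by blast
      qed
    qed
    then show ?case by (intro derived_series_Suc_subset subspace_upper) simp
  next
    case (Suc n)
    show ?case
    proof (rule derived_series_Suc_subset[OF subspace_upper])
      fix v w
      assume "v \<in> derived_series (upper x 0) (Suc n)" "w \<in> derived_series (upper x 0) (Suc n)"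
      then have "bracket v w \<in> upper x (real (Suc n) * d + real (Suc n) * d)"
        using Suc.IH bracket_upper by blast
      moreover have "real (Suc (Suc n)) * d \<le> real (Suc n) * d + real (Suc n) * d"
        using d(1) by (simp add: algebra_simps)
      ultimately show "bracket v w \<in> upper x (real (Suc (Suc n)) * d)"
        using upper_antimono by blast
    qed
  qed
  obtain n where "c < real n * d" using reals_Archimedean3[OF d(1)] by blast
  then have "c \<le> real (Suc n) * d" using d(1) by (simp add: algebra_simps)
  then have "derived_series (upper x 0) (Suc n) \<subseteq> {0}" using ds c by metis
  then have "derived_series (upper x 0) (Suc n) = {0}"
    using subspace_0[OF subspace_derived_series[OF subspace_upper]] by blast
  moreover have "lie_subalgebra (upper x 0)"
    using bracket_upper[of _ x 0 _ 0] by (simp add: lie_subalgebra_def subspace_upper)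
  ultimately show ?thesis unfolding solvable_subalgebra_def by blast
qed

text \<open>Let \<open>T\<close> be a larger solvable subalgebra. Modulo \<open>upper x 0\<close>, each element of \<open>T\<close> is congruent to a
real element of \<open>T\<close>. The latter lies in \<open>T \<inter> cj T\<close>, which is abelian and contains \<open>x\<close>, so it
commutes with \<open>x\<close>.\<close>

lemma borel_upper:
  assumes x: "cj x = x"
    and abelian: "\<And>v w. v \<in> eigenspace (bracket x) 0 \<Longrightarrow> w \<in> eigenspace (bracket x) 0 \<Longrightarrow> bracket v w = 0"
  shows "borel_subalgebra (upper x 0)"
  unfolding borel_subalgebra_def
proof (intro conjI allI impI)
  show "solvable_subalgebra (upper x 0)" using assms by (rule solvable_upper)
  fix T assume "solvable_subalgebra T \<and> upper x 0 \<subseteq> T"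
  then have T: "subspace T" "\<And>a b. a \<in> T \<Longrightarrow> b \<in> T \<Longrightarrow> bracket a b \<in> T" "upper x 0 \<subseteq> T"
    and "\<exists>n. derived_series T n = {0}"
    by (auto simp: solvable_subalgebra_def lie_subalgebra_def)
  then obtain n where n: "derived_series T n = {0}" by blast
  define T' where "T' = T \<inter> {x. cj x \<in> T}"
  have T': "subspace T'"
    unfolding T'_def using T(1) by (intro subspace_inter subspace_cj_image)
  have "derived_series T' n \<subseteq> {0}"
    using derived_series_mono[of T' T n] n by (auto simp: T'_def)
  then have n': "derived_series T' n = {0}"
    using subspace_0[OF subspace_derived_series[OF T']] by blast
  have ab: "bracket a b = 0" if "a \<in> T'" "b \<in> T'" for a b
    using T' _ _ n' that
    by (rule solvable_conjugation_stable_abelian) (auto simp: T'_def T cj_bracket)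
  have "x \<in> upper x 0"
    using eigenspace_subset_upper[of 0 0 x] by (auto simp: eigenspace_def bracket_self)
  then have xT: "x \<in> T'" using T(3) x by (auto simp: T'_def)
  have "T \<subseteq> upper x 0"
  proof
    fix t assume t: "t \<in> T"
    obtain a b where t_eq: "a \<in> upper x 0" "b \<in> upper x 0" "t = a + cj b"
      using upper_plus_conjugate[OF x] by blast
    define r where "r = b + cj b"
    have "cj b = t - a" using t_eq(3) by simp
    then have "r \<in> T"
      using t_eq T(1,3) t unfolding r_def by (metis subsetD subspace_add subspace_diff)
    moreover have "cj r = r" by (simp add: r_def cj_add add.commute)
    ultimately have "r \<in> T'" by (simp add: T'_def)
    then have "r \<in> eigenspace (bracket x) 0" using ab[OF xT] by (simp add: eigenspace_def)
    then have r: "r \<in> upper x 0" using eigenspace_subset_upper[of 0 0 x] by blast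
    have "t = a + (r - b)" using t_eq(3) by (simp add: r_def)
    then show "t \<in> upper x 0"
      using t_eq r subspace_upper[of x 0] by (metis subspace_add subspace_diff)
  qed
  then show "T = upper x 0" using T(3) by blast
qed

section \<open>The moment map of a subalgebra\<close>

text \<open>For an orthonormal set \<open>E\<close> this is the trace of \<open>P ad z\<close>, where \<open>P\<close> is the orthogonal projection
onto the span of \<open>E\<close>.\<close>

definition compressed_trace :: "'v set \<Rightarrow> 'v \<Rightarrow> complex" where
  "compressed_trace E z = (\<Sum>e\<in>E. ip (bracket z e) e)"

text \<open>Any linear functional is \<open>z \<mapsto> \<langle>z, y\<rangle>\<close> for some \<open>y\<close>. Since \<open>ad (cj z)\<close> is minus the adjoint of \<open>ad z\<close>,
this one turns \<open>cj\<close> into the negative of complex conjugation, hence \<open>cj y = - y\<close> and \<open>i y\<close> is real.\<close>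

lemma compressed_trace_represented:
  obtains x where "cj x = x" "\<And>z. compressed_trace E z = \<i> * ip z x"
proof -
  obtain B where B: "orthonormal B" "span B = UNIV"
    using exists_orthonormal_basis subspace_UNIV by blast
  have add: "compressed_trace E (a + b) = compressed_trace E a + compressed_trace E b"
    and scale: "compressed_trace E (c *c a) = c * compressed_trace E a" for a b c
    by (simp_all add: compressed_trace_def bracket_simps ip_simps sum.distrib sum_distrib_left)
  have sum: "compressed_trace E (sum f C) = (\<Sum>c\<in>C. compressed_trace E (f c))" if "finite C" for f C
    using that
  proof induction
    case empty
    show ?case by (simp add: compressed_trace_def)
  qed (simp add: add)
  define y where "y = (\<Sum>b\<in>B. cnj (compressed_trace E b) *c b)"
  have y: "compressed_trace E z = ip z y" for z
  proof -
    have "compressed_trace E z = compressed_trace E (proj B z)" using proj_eq[OF B(1)] B(2) by simp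
    also have "\<dots> = ip z y"
      using B(1) by (simp add: proj_def y_def sum scale ip_simps orthonormal_def mult.commute)
    finally show ?thesis .
  qed
  have "ip z (y + cj y) = 0" for z
  proof -
    have "ip (bracket (cj z) e) e = - cnj (ip (bracket z e) e)" for z e
      using bracket_adjoint[of "cj z" e e] ip_commute[of "bracket z e" e] by simp
    then have "compressed_trace E (cj z) = - cnj (compressed_trace E z)" for z
      by (simp add: compressed_trace_def sum_negf)
    then have "ip z y = - cnj (ip (cj z) y)" using y by (metis cj_cj)
    also have "\<dots> = - ip z (cj y)" using ip_cj[of "cj z" y] by simp
    finally show ?thesis by (simp add: ip_simps)
  qed
  then have "y + cj y = 0" using ip_self_eq_0_iff by blast
  then have cy: "cj y = - y" by (simp add: eq_neg_iff_add_eq_0 add.commute)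
  show thesis
    using that[of "\<i> *c y"] by (simp add: cj_scale cy y ip_simps scale_minus_right scale_minus_left)
qed

text \<open>Put \<open>A = ad z\<close>, so \<open>ad (cj z) = - A\<^sup>*\<close> and the left-hand side is \<open>tr (P A A\<^sup>* P) - tr (P A\<^sup>* A P)\<close>, that is,
\<open>\<parallel>A\<^sup>* P\<parallel>\<^sup>2 - \<parallel>A P\<parallel>\<^sup>2\<close> in Hilbert-Schmidt norms. As \<open>A\<close> preserves the range of \<open>P\<close>, one has
\<open>\<parallel>A P\<parallel> = \<parallel>P A P\<parallel> = \<parallel>P A\<^sup>* P\<parallel>\<close>, and what remains is \<open>\<parallel>(1 - P) A\<^sup>* P\<parallel>\<^sup>2\<close>.\<close>

lemma compressed_trace_commutator:
  assumes E: "orthonormal E" and z: "z \<in> normalizer (span E)"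
  defines "r \<equiv> \<lambda>e. bracket (cj z) e - proj E (bracket (cj z) e)"
  shows "compressed_trace E (bracket (cj z) z) = (\<Sum>e\<in>E. ip (r e) (r e))"
proof -
  have r: "ip (r e) (r e) = ip (bracket (cj z) e) (bracket (cj z) e)
      - (\<Sum>f\<in>E. ip (bracket (cj z) e) f * ip f (bracket (cj z) e))" for e
  proof -
    have "ip (r e) (proj E (bracket (cj z) e)) = 0"
      unfolding r_def using ip_diff_proj[OF E] proj_in_span by blast
    then have "ip (r e) (r e) = ip (r e) (bracket (cj z) e)"
      unfolding r_def by (simp add: ip_diff_right)
    then show ?thesis by (simp add: r_def ip_diff_left ip_proj_left)
  qed
  have t: "ip (bracket (bracket (cj z) z) e) e = ip (bracket (cj z) e) (bracket (cj z) e)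
      - (\<Sum>f\<in>E. ip (bracket (cj z) f) e * ip e (bracket (cj z) f))" if "e \<in> E" for e
  proof -
    have "bracket z e \<in> span E" using z that by (simp add: normalizer_def span_base)
    then have "ip (bracket z e) (bracket z e) = ip (proj E (bracket z e)) (bracket z e)"
      using proj_eq[OF E] by simp
    also have "\<dots> = (\<Sum>f\<in>E. ip (bracket z e) f * ip f (bracket z e))"
      by (rule ip_proj_left)
    also have "\<dots> = (\<Sum>f\<in>E. ip (bracket (cj z) f) e * ip e (bracket (cj z) f))"
    proof (rule sum.cong)
      fix f
      have "ip f (bracket z e) = - ip (bracket (cj z) f) e" by (simp add: bracket_adjoint)
      then show "ip (bracket z e) f * ip f (bracket z e)
          = ip (bracket (cj z) f) e * ip e (bracket (cj z) f)"
        by (simp add: bracket_adjoint[of z e f])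
    qed simp
    finally have "ip (bracket z e) (bracket z e)
        = (\<Sum>f\<in>E. ip (bracket (cj z) f) e * ip e (bracket (cj z) f))" .
    moreover have "bracket (bracket (cj z) z) e = bracket (cj z) (bracket z e) - bracket z (bracket (cj z) e)"
      using bracket_derivation[of "cj z" z e] by simp
    ultimately show ?thesis
      by (simp add: ip_diff_left bracket_adjoint[of z "bracket (cj z) e"]
          bracket_adjoint[of "cj z" "bracket z e"])
  qed
  have "compressed_trace E (bracket (cj z) z) = (\<Sum>e\<in>E. ip (bracket (cj z) e) (bracket (cj z) e))
      - (\<Sum>e\<in>E. \<Sum>f\<in>E. ip (bracket (cj z) f) e * ip e (bracket (cj z) f))"
    unfolding compressed_trace_def by (simp add: t sum_subtractf)
  also have "\<dots> = (\<Sum>e\<in>E. ip (bracket (cj z) e) (bracket (cj z) e))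
      - (\<Sum>e\<in>E. \<Sum>f\<in>E. ip (bracket (cj z) e) f * ip f (bracket (cj z) e))"
    by (subst sum.swap) simp
  also have "\<dots> = (\<Sum>e\<in>E. ip (r e) (r e))"
    by (simp add: r sum_subtractf)
  finally show ?thesis .
qed

lemma compressed_trace_nonneg:
  assumes "orthonormal E" "z \<in> normalizer (span E)"
  shows "0 \<le> Re (compressed_trace E (bracket (cj z) z))"
  unfolding compressed_trace_commutator[OF assms] Re_sum by (intro sum_nonneg Re_ip_self_nonneg)

lemma conjugate_normalizes_if_compressed_trace_zero:
  assumes E: "orthonormal E" and z: "z \<in> normalizer (span E)"
    and 0: "compressed_trace E (bracket (cj z) z) = 0"
  shows "cj z \<in> normalizer (span E)"
proof -
  define r where "r e = bracket (cj z) e - proj E (bracket (cj z) e)" for e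
  have "(\<Sum>e\<in>E. Re (ip (r e) (r e))) = 0"
    using compressed_trace_commutator[OF E z] 0 by (simp add: r_def flip: Re_sum)
  then have "Re (ip (r e) (r e)) = 0" if "e \<in> E" for e
    using E that sum_nonneg_eq_0_iff[of E "\<lambda>e. Re (ip (r e) (r e))"] Re_ip_self_nonneg
    by (auto simp: orthonormal_def)
  then have "r e = 0" if "e \<in> E" for e
    using that ip_pos[of "r e"] by fastforce
  then have "bracket (cj z) e \<in> span E" if "e \<in> E" for e
    using that proj_in_span[of E "bracket (cj z) e"] by (simp add: r_def)
  then have "bracket (cj z) y \<in> span E" if "y \<in> span E" for y
    using span_bracket_subset[of "span E" "{cj z}" E "cj z" y] that by (simp add: span_base)
  then show ?thesis by (simp add: normalizer_def)
qed

text \<open>The element \<open>x\<close> represents the compressed trace of \<open>q\<close>. For \<open>z\<close> in the normalizer \<open>p\<close> with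
\<open>[x, z] = i l z\<close> the compressed trace of \<open>[cj z, z]\<close> is \<open>l \<parallel>z\<parallel>\<^sup>2\<close>, so \<open>l \<ge> 0\<close> unless \<open>z = 0\<close>. An eigenvector
with positive eigenvalue therefore has no component in \<open>cj p\<close>, and its component orthogonal to
\<open>p\<close> is orthogonal to \<open>p + cj p\<close>, that is, zero. The centralizer of \<open>x\<close> is spanned by real
elements, for which the compressed trace of \<open>[cj z, z]\<close> vanishes if \<open>z \<in> q\<close> has the given
element as twice its real part.\<close>

lemma exists_upper_subset_normalizer:
  assumes q: "lie_subalgebra q" and cover: "\<And>x. cj x = x \<Longrightarrow> \<exists>z\<in>q. z + cj z = x"
  obtains x where "cj x = x" "upper x 0 \<subseteq> normalizer q"
proof -
  have subq: "subspace q" using q by (simp add: lie_subalgebra_def)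
  obtain E where E: "orthonormal E" "span E = q" using exists_orthonormal_basis[OF subq] by blast
  define p where "p = normalizer q"
  obtain x where x: "cj x = x" and tr: "\<And>z. compressed_trace E z = \<i> * ip z x"
    using compressed_trace_represented by blast
  have p: "lie_subalgebra p" unfolding p_def using subq by (rule lie_subalgebra_normalizer)
  then have subp: "subspace p" by (simp add: lie_subalgebra_def)
  have qp: "q \<subseteq> p" using q by (auto simp: p_def normalizer_def lie_subalgebra_def)
  have pos: "0 \<le> Re (compressed_trace E (bracket (cj z) z))" if "z \<in> p" for z
    using compressed_trace_nonneg[OF E(1)] that E(2) by (simp add: p_def)
  have zero: "cj z \<in> p" if "z \<in> p" "compressed_trace E (bracket (cj z) z) = 0" for z
    using conjugate_normalizes_if_compressed_trace_zero[OF E(1)] that E(2) by (simp add: p_def)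
  have real_centralizer: "y \<in> p" if y: "cj y = y" "bracket y x = 0" for y
  proof -
    obtain z where z: "z \<in> q" "z + cj z = y" using cover[OF y(1)] by blast
    have "bracket y z = bracket (cj z) z"
      unfolding z(2)[symmetric] by (simp add: bracket_simps bracket_self)
    then have "compressed_trace E (bracket (cj z) z) = - \<i> * ip z (bracket y x)"
      using y(1) by (simp add: tr bracket_adjoint flip: \<open>bracket y z = bracket (cj z) z\<close>)
    then have "compressed_trace E (bracket (cj z) z) = 0" using y(2) by simp
    then have "cj z \<in> p" using zero z(1) qp by blast
    then show ?thesis using z qp subp subspace_add by blast
  qed
  have xp: "x \<in> p" using real_centralizer x by (simp add: bracket_self)
  have adp: "bracket x ` p \<subseteq> p" using p xp by (auto simp: lie_subalgebra_def)
  define p' where "p' = {z. cj z \<in> p}"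
  have subp': "subspace p'" unfolding p'_def using subp by (rule subspace_cj_image)
  have adp': "bracket x ` p' \<subseteq> p'" using adp x by (auto simp: p'_def cj_bracket)
  have sk: "skew_hermitian (bracket x)" using skew_hermitian_ad[OF x] .
  have eigen0: "eigenspace (bracket x) 0 \<subseteq> p"
  proof (rule subset_if_real_points_subset)
    show "subspace (eigenspace (bracket x) 0)"
      by (rule subspace_eigenspace[OF linear_bracket_right])
    show "cj v \<in> eigenspace (bracket x) 0" if "v \<in> eigenspace (bracket x) 0" for v
      using cj_eigenspace[OF x that] by simp
    show "v \<in> p" if "v \<in> eigenspace (bracket x) 0" "cj v = v" for v
      using real_centralizer[OF that(2)] that(1) bracket_anticommute[of x v]
      by (simp add: eigenspace_def)
  qed (rule subp)
  \<comment> \<open>conjugation reverses the sign of eigenvalues, so those on \<open>cj p\<close> are nonpositive\<close>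
  have neg_part: "c = 0" if c: "c \<in> p'" "c \<in> eigenspace (bracket x) l" and "0 < l" for c l
  proof -
    define z where "z = cj c"
    have zp: "z \<in> p" using c(1) by (simp add: z_def p'_def)
    have ze: "z \<in> eigenspace (bracket x) (- l)" unfolding z_def using cj_eigenspace[OF x c(2)] .
    have "compressed_trace E (bracket (cj z) z) = - \<i> * ip z (bracket z x)"
      by (simp add: tr bracket_adjoint)
    also have "\<dots> = \<i> * ip z (bracket x z)"
      by (simp add: bracket_anticommute[of x z] ip_simps)
    also have "\<dots> = - of_real l * ip z z"
      using ze by (simp add: eigenspace_def ip_simps mult.assoc[symmetric])
    finally have "0 \<le> - l * Re (ip z z)" using pos[OF zp] by simp
    then have "z = 0" using ip_pos[of z] \<open>0 < l\<close> by (auto simp: mult_le_0_iff)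
    then show ?thesis using cj_cj[of c] by (simp add: z_def)
  qed
  have cover': "\<exists>a\<in>p. \<exists>b\<in>p'. v = a + b" for v
  proof -
    have "UNIV \<subseteq> {a + b | a b. a \<in> p \<and> b \<in> p'}"
    proof (rule subset_if_real_points_subset)
      show "subspace {a + b | a b. a \<in> p \<and> b \<in> p'}" using subp subp' by (rule subspace_sums)
      fix y assume "cj y = y"
      then obtain z where "z \<in> q" "z + cj z = y" using cover by blast
      then show "y \<in> {a + b | a b. a \<in> p \<and> b \<in> p'}" using qp by (force simp: p'_def)
    qed auto
    then show ?thesis by blast
  qed
  have eigen_pos: "eigenspace (bracket x) l \<subseteq> p" if "0 < l" for l
  proof
    fix v assume v: "v \<in> eigenspace (bracket x) l"
    obtain v1 v2 where v12: "v = v1 + v2" "v1 \<in> p" "\<And>s. s \<in> p \<Longrightarrow> ip v2 s = 0"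
      using orthogonal_decomposition[OF subp] by blast
    have e2: "v2 \<in> eigenspace (bracket x) l"
      using eigenvector_components(2)[OF sk subp adp _ v12(2,3)] v v12(1) by blast
    obtain c d where cd: "v2 = c + d" "c \<in> p'" "\<And>s. s \<in> p' \<Longrightarrow> ip d s = 0"
      using orthogonal_decomposition[OF subp'] by blast
    have "c \<in> eigenspace (bracket x) l"
      using eigenvector_components(1)[OF sk subp' adp' _ cd(2,3)] e2 cd(1) by blast
    then have "c = 0" using neg_part cd(2) \<open>0 < l\<close> by blast
    then have o': "ip v2 s = 0" if "s \<in> p'" for s using cd that by simp
    obtain a b where "a \<in> p" "b \<in> p'" "v2 = a + b" using cover' by blast
    then have "ip v2 v2 = 0" using v12(3)[of a] o'[of b] by (metis add.right_neutral ip_add_right)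
    then show "v \<in> p" using v12 by simp
  qed
  have "upper x 0 \<subseteq> p"
    unfolding upper_def
  proof (rule span_minimal[OF _ subp], rule UN_least)
    fix l :: real assume "l \<in> {0..}"
    then show "eigenspace (bracket x) l \<subseteq> p"
      using eigen0 eigen_pos[of l] by (cases "l = 0") auto
  qed
  then show thesis using that[OF x] by (simp add: p_def)
qed

section \<open>Parabolicity of normalizers\<close>

text \<open>On common eigenvectors of \<open>ad x\<close> and \<open>ad y\<close>, which span, the perturbation moves the eigenvalue of
\<open>ad x\<close> by less than the spectral gap \<open>d\<close> of \<open>ad x\<close> at zero. So no nonzero eigenvalue vanishes or changes
sign.\<close>

lemma regular_perturbation:
  assumes x: "cj x = x" and y: "cj y = y" and xy: "bracket x y = 0"
  obtains e where "e > 0"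
    "upper (x + of_real e *c y) 0 \<subseteq> upper x 0"
    "eigenspace (bracket (x + of_real e *c y)) 0 \<subseteq> eigenspace (bracket x) 0"
proof -
  obtain d where d: "d > 0" "\<And>l. l > 0 \<Longrightarrow> l < d \<Longrightarrow> eigenspace (bracket x) l = {0}"
    using positive_spectral_gap[OF x] by blast
  have gap: "d \<le> \<bar>a\<bar>" if "v \<in> eigenspace (bracket x) a" "v \<noteq> 0" "a \<noteq> 0" for v a
  proof (rule ccontr)
    assume "\<not> d \<le> \<bar>a\<bar>"
    moreover have "cj v \<noteq> 0" using that(2) cj_cj[of v] cj_zero by metis
    ultimately show False
      using d(2)[of a] d(2)[of "- a"] that cj_eigenspace[OF x that(1)] by force
  qed
  have "finite {l. eigenspace (bracket y) l \<noteq> {0}}"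
    using finite_spectrum skew_hermitian_ad[OF y] by blast
  then have "bdd_above (abs ` {l. eigenspace (bracket y) l \<noteq> {0}})" by simp
  then obtain M where M: "\<And>l. eigenspace (bracket y) l \<noteq> {0} \<Longrightarrow> \<bar>l\<bar> \<le> M"
    unfolding bdd_above_def by auto
  \<comment> \<open>the absolute value and the summand 1 keep the denominator positive\<close>
  define e where "e = d / (\<bar>M\<bar> + 1)"
  have e: "e > 0" using d(1) by (simp add: e_def)
  define w where "w = x + of_real e *c y"
  have w: "cj w = w" by (simp add: w_def cj_add cj_scale x y)
  have small: "\<bar>k - a\<bar> < d"
    if v: "v \<in> eigenspace (bracket x) a" "v \<in> eigenspace (bracket w) k" "v \<noteq> 0" for v a k
  proof -
    have "of_real e *c bracket y v = (\<i> * of_real (k - a)) *c v"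
      using v(1,2) by (simp add: eigenspace_def w_def bracket_simps algebra_simps)
    then have "(1 / of_real e) *c (of_real e *c bracket y v)
        = (1 / of_real e) *c ((\<i> * of_real (k - a)) *c v)"
      by simp
    then have "v \<in> eigenspace (bracket y) ((k - a) / e)"
      using e by (simp add: eigenspace_def)
    then have "\<bar>(k - a) / e\<bar> \<le> M" using M v(3) by blast
    then have "\<bar>k - a\<bar> \<le> M * e" using e by (simp add: abs_divide pos_divide_le_eq)
    also have "\<dots> < (\<bar>M\<bar> + 1) * e" using e by simp
    also have "\<dots> = d" by (simp add: e_def)
    finally show ?thesis .
  qed
  have joint: "eigenspace (bracket w) k
      \<subseteq> span (\<Union>a. eigenspace (bracket x) a \<inter> eigenspace (bracket w) k)" for k
  proof (rule invariant_subspace_span_eigenvectors[OF skew_hermitian_ad[OF x]])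
    show "subspace (eigenspace (bracket w) k)"
      by (rule subspace_eigenspace[OF linear_bracket_right])
    have "bracket y x = 0" using xy bracket_anticommute[of x y] by simp
    then have "x \<in> eigenspace (bracket w) 0"
      by (simp add: eigenspace_def w_def bracket_simps bracket_self)
    then show "bracket x ` eigenspace (bracket w) k \<subseteq> eigenspace (bracket w) k"
      using bracket_eigenspaces[of x w 0 _ k] by auto
  qed
  have "upper w 0 \<subseteq> upper x 0"
    unfolding upper_def[of w]
  proof (rule span_minimal[OF _ subspace_upper], rule UN_least)
    fix k :: real assume k: "k \<in> {0..}"
    have "span (\<Union>a. eigenspace (bracket x) a \<inter> eigenspace (bracket w) k) \<subseteq> upper x 0"
    proof (rule span_minimal[OF _ subspace_upper], clarify)
      fix a v assume v: "v \<in> eigenspace (bracket x) a" "v \<in> eigenspace (bracket w) k"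
      show "v \<in> upper x 0"
      proof (cases "v = 0")
        case True
        then show ?thesis by (simp add: subspace_0 subspace_upper)
      next
        case False
        have "0 \<le> a"
        proof (rule ccontr)
          assume "\<not> 0 \<le> a"
          then show False using gap[OF v(1) False] small[OF v False] k by auto
        qed
        then show ?thesis using v(1) eigenspace_subset_upper by blast
      qed
    qed
    then show "eigenspace (bracket w) k \<subseteq> upper x 0" using joint by blast
  qed
  moreover have "eigenspace (bracket w) 0 \<subseteq> eigenspace (bracket x) 0"
  proof -
    have sub: "subspace (eigenspace (bracket x) 0)"
      by (rule subspace_eigenspace[OF linear_bracket_right])
    have "span (\<Union>a. eigenspace (bracket x) a \<inter> eigenspace (bracket w) 0) \<subseteq> eigenspace (bracket x) 0"
    proof (rule span_minimal[OF _ sub], clarify)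
      fix a v assume v: "v \<in> eigenspace (bracket x) a" "v \<in> eigenspace (bracket w) 0"
      show "v \<in> eigenspace (bracket x) 0"
      proof (cases "v = 0")
        case True
        then show ?thesis by (simp add: subspace_0 sub)
      next
        case False
        have "a = 0" using gap[OF v(1) False] small[OF v False] by auto
        then show ?thesis using v(1) by simp
      qed
    qed
    then show ?thesis using joint by blast
  qed
  ultimately show thesis using that[OF e] by (simp add: w_def)
qed

text \<open>If the centralizer of \<open>x\<close> is not abelian, perturb \<open>x\<close> by a real element of the centralizer that is not
central in it. The new centralizer is strictly smaller.\<close>

lemma exists_regular_upper:
  assumes "cj x = x"
  shows "\<exists>z. cj z = z \<and> upper z 0 \<subseteq> upper x 0 \<and>
    (\<forall>v\<in>eigenspace (bracket z) 0. \<forall>w\<in>eigenspace (bracket z) 0. bracket v w = 0)"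
  using assms
proof (induction "dim (eigenspace (bracket x) 0)" arbitrary: x rule: less_induct)
  case less
  define Z where "Z = eigenspace (bracket x) 0"
  have Z: "subspace Z" unfolding Z_def by (rule subspace_eigenspace[OF linear_bracket_right])
  have cjZ: "cj v \<in> Z" if "v \<in> Z" for v
    using cj_eigenspace[OF less.prems, of v 0] that by (simp add: Z_def)
  show ?case
  proof (cases "\<forall>v\<in>Z. \<forall>w\<in>Z. bracket v w = 0")
    case True
    then show ?thesis using less.prems unfolding Z_def by blast
  next
    case False
    then obtain v w where vw: "v \<in> Z" "w \<in> Z" "bracket v w \<noteq> 0" by blast
    have "\<exists>y\<in>Z. cj y = y \<and> bracket y w \<noteq> 0"
    proof (rule ccontr)
      assume none: "\<not> ?thesis"
      have "Z \<subseteq> {v. bracket v w = 0}"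
        using Z cjZ none
        by (intro subset_if_real_points_subset) (auto simp: subspace_def bracket_simps)
      then show False using vw by blast
    qed
    then obtain y where y: "y \<in> Z" "cj y = y" "bracket y w \<noteq> 0" by blast
    have "bracket x y = 0" using y(1) by (simp add: Z_def eigenspace_def)
    then obtain e where e: "e > 0"
        "upper (x + of_real e *c y) 0 \<subseteq> upper x 0"
        "eigenspace (bracket (x + of_real e *c y)) 0 \<subseteq> Z"
      unfolding Z_def using regular_perturbation[OF less.prems y(2)] by metis
    define x' where "x' = x + of_real e *c y"
    have x': "cj x' = x'" by (simp add: x'_def cj_add cj_scale less.prems y(2))
    have "bracket x w = 0" using vw(2) by (simp add: Z_def eigenspace_def)
    then have "w \<notin> eigenspace (bracket x') 0"
      using y(3) e(1) by (simp add: eigenspace_def x'_def bracket_simps)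
    then have "eigenspace (bracket x') 0 \<subset> Z" using e(3) vw(2) by (auto simp: x'_def)
    then have "dim (eigenspace (bracket x') 0) < dim Z"
      using Z subspace_eigenspace[OF linear_bracket_right, of x' 0]
      by (intro dim_psubset) (simp add: span_eq_iff[THEN iffD2])
    then show ?thesis using less.hyps[OF _ x'] e(2) unfolding Z_def x'_def by blast
  qed
qed

text \<open>Geometrically: if the compact group of the real form acts transitively on the orbit of \<open>q\<close> under the complex
group in the Grassmannian of subspaces, then that orbit is compact, hence a flag variety. The covering assumption is the
infinitesimal form of transitivity.\<close>

theorem parabolic_normalizer:
  assumes q: "lie_subalgebra q" and cover: "\<And>x. cj x = x \<Longrightarrow> \<exists>z\<in>q. z + cj z = x"
  shows "parabolic_subalgebra (normalizer q)"
proof -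
  obtain x where x: "cj x = x" "upper x 0 \<subseteq> normalizer q"
    using exists_upper_subset_normalizer[OF q cover] by blast
  obtain z where z: "cj z = z" "upper z 0 \<subseteq> upper x 0"
      "\<forall>v\<in>eigenspace (bracket z) 0. \<forall>w\<in>eigenspace (bracket z) 0. bracket v w = 0"
    using exists_regular_upper[OF x(1)] by blast
  have "borel_subalgebra (upper z 0)" using borel_upper[OF z(1)] z(3) by blast
  moreover have "lie_subalgebra (normalizer q)"
    using q by (intro lie_subalgebra_normalizer) (simp add: lie_subalgebra_def)
  ultimately show ?thesis using x(2) z(2) unfolding parabolic_subalgebra_def by blast
qed

end

section \<open>Complexification of a Lie algebra with invariant inner product\<close>

text \<open>The sesquilinear extension, antilinear in the second argument.\<close>

definition complexify_form :: "('g \<Rightarrow> 'g \<Rightarrow> real) \<Rightarrow> 'g \<times> 'g \<Rightarrow> 'g \<times> 'g \<Rightarrow> complex" where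
  "complexify_form B z w =
     Complex (B (fst z) (fst w) + B (snd z) (snd w)) (B (snd z) (fst w) - B (fst z) (snd w))"

definition conjugate :: "'g::uminus \<times> 'g \<Rightarrow> 'g \<times> 'g" where
  "conjugate z = (fst z, - snd z)"

lemma compact_real_form_complexification:
  fixes br :: "'g::real_vector \<Rightarrow> 'g \<Rightarrow> 'g"
  assumes lie: "lie_algebra scaleR br"
    and fin: "finite S" "span S = (UNIV :: 'g set)"
    and B: "invariant_inner_product br B"
  obtains Basis where
    "compact_real_form (cscale scaleR) Basis (complexify_form B) (cbracket br) conjugate"
proof -
  interpret g: lie_algebra scaleR br by fact
  interpret c: lie_algebra "cscale scaleR" "cbracket br" using lie by (rule lie_algebra_complexification)
  have "(x, 0) \<in> c.span (cembed ` S)" for x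
  proof -
    have "x \<in> span S" using fin(2) by simp
    then show ?thesis
    proof (induction rule: span_induct_alt)
      case base
      show ?case using c.span_zero[of "cembed ` S"] by (simp add: zero_prod_def)
    next
      case (step c a y)
      have "cscale scaleR (of_real c) (a, 0) + (y, 0) \<in> c.span (cembed ` S)"
        using step by (intro c.span_add c.span_scale) (auto intro: c.span_base simp: cembed_def image_iff)
      moreover have "cscale scaleR (of_real c) (a, 0) + (y, 0) = (c *\<^sub>R a + y, 0)"
        by (simp add: cscale_def)
      ultimately show ?case by simp
    qed
  qed
  then have "(x, 0) + cscale scaleR \<i> (y, 0) \<in> c.span (cembed ` S)" for x y
    by (intro c.span_add c.span_scale)
  then have "(x, y) \<in> c.span (cembed ` S)" for x y
    by (simp add: cscale_def)
  then have full: "c.span (cembed ` S) = UNIV" by auto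
  obtain b where b: "b \<subseteq> cembed ` S" "c.independent b" "cembed ` S \<subseteq> c.span b"
    using c.basis_exists by metis
  have "c.span b = UNIV"
    using full c.span_minimal[OF b(3) c.subspace_span] by blast
  moreover have "finite b" using b(1) fin(1) finite_subset by blast
  ultimately have fd: "finite_dimensional_vector_space (cscale scaleR :: _ \<Rightarrow> 'g \<times> 'g \<Rightarrow> _) b"
    using b(2) by unfold_locales auto
  have bil: "bilinear B" and sym: "\<And>x y. B x y = B y x" and pos: "\<And>x. x \<noteq> 0 \<Longrightarrow> B x x > 0"
    and inv: "\<And>x y z. B (br x y) z + B y (br x z) = 0"
    using B by (auto simp: invariant_inner_product_def)
  note B_simps = bilinear_ladd[OF bil] bilinear_radd[OF bil] bilinear_lmul[OF bil]
    bilinear_rmul[OF bil] bilinear_lneg[OF bil] bilinear_rneg[OF bil] bilinear_lsub[OF bil]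
    bilinear_rsub[OF bil]
  have nonneg: "0 \<le> B x x" for x
    using pos[of x] bilinear_lzero[OF bil] by (cases "x = 0") auto
  have inv': "B (br x y) z = - B y (br x z)" for x y z using inv[of x y z] by simp
  have "compact_real_form (cscale scaleR) b (complexify_form B) (cbracket br) conjugate"
  proof (intro compact_real_form.intro hermitian_space.intro complex_vector_space.intro fd
      hermitian_space_axioms.intro compact_real_form_axioms.intro c.lie_algebra_axioms)
    fix x y z :: "'g \<times> 'g" and c :: complex
    show "complexify_form B (x + y) z = complexify_form B x z + complexify_form B y z"
      by (simp add: complexify_form_def B_simps complex_eq_iff)
    show "complexify_form B (cscale scaleR c x) y = c * complexify_form B x y"
      by (simp add: complexify_form_def cscale_def B_simps complex_eq_iff algebra_simps)
    show "complexify_form B y x = cnj (complexify_form B x y)"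
      by (simp add: complexify_form_def complex_eq_iff sym[of "fst x"] sym[of "snd x"])
    show "0 < Re (complexify_form B x x)" if "x \<noteq> 0"
    proof -
      have "fst x \<noteq> 0 \<or> snd x \<noteq> 0" using that by (simp add: prod_eq_iff)
      then show ?thesis
        using pos[of "fst x"] pos[of "snd x"] nonneg[of "fst x"] nonneg[of "snd x"]
        by (auto simp: complexify_form_def intro: add_pos_nonneg add_nonneg_pos)
    qed
    show "conjugate (conjugate x) = x" by (simp add: conjugate_def)
    show "conjugate (x + y) = conjugate x + conjugate y" by (simp add: conjugate_def)
    show "conjugate (cscale scaleR c x) = cscale scaleR (cnj c) (conjugate x)"
      by (simp add: conjugate_def cscale_def)
    show "conjugate (cbracket br x y) = cbracket br (conjugate x) (conjugate y)"
      by (simp add: conjugate_def cbracket_def g.bracket_simps)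
    show "complexify_form B (conjugate x) (conjugate y) = cnj (complexify_form B x y)"
      by (simp add: complexify_form_def conjugate_def complex_eq_iff B_simps)
    show "complexify_form B (cbracket br z x) y = - complexify_form B x (cbracket br (conjugate z) y)"
      by (simp add: complexify_form_def conjugate_def cbracket_def complex_eq_iff B_simps
          g.bracket_simps inv')
  qed
  then show thesis by (rule that)
qed

section \<open>Complex structures on a quotient\<close>

lemma coset_eq_iff:
  assumes "subspace (h :: 'g::real_vector set)"
  shows "x +o h = y +o h \<longleftrightarrow> x - y \<in> h"
proof
  assume "x +o h = y +o h"
  moreover have "x \<in> x +o h" using subspace_0[OF assms] by (force simp: elt_set_plus_def)
  ultimately show "x - y \<in> h" by (auto simp: elt_set_plus_def)
next
  assume "x - y \<in> h"
  then have "x +o h = y +o ((x - y) +o h)" by (simp add: set_plus_rearrange2)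
  also have "(x - y) +o h = h"
  proof -
    have "a \<in> (x - y) +o h" if "a \<in> h" for a
      using subspace_diff[OF assms that \<open>x - y \<in> h\<close>] by (force simp: elt_set_plus_def)
    then show ?thesis using subspace_add[OF assms \<open>x - y \<in> h\<close>] by (auto simp: elt_set_plus_def)
  qed
  finally show "x +o h = y +o h" .
qed

locale complex_quotient =
  fixes h :: "'g::real_vector set" and J :: "'g set \<Rightarrow> 'g set"
  assumes subspace_h: "subspace h"
    and J_endo: "quot_endo h J"
    and J_square: "\<And>A. A \<in> quot h \<Longrightarrow> J (J A) = qscale h (- 1) A"
begin

lemma coset_in_quot [simp]: "x +o h \<in> quot h"
  by (simp add: quot_def)

lemma h_plus_coset [simp]: "h + (x +o h) = x +o h"
  using qadd_coset[OF subspace_h, of 0 x] by simp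

lemma J_coset: obtains y where "J (x +o h) = y +o h"
proof -
  have "J (x +o h) \<in> quot h" using J_endo by (simp add: quot_endo_def)
  then show thesis using that by (auto simp: quot_def)
qed

lemma J_add: "J ((x + y) +o h) = J (x +o h) + J (y +o h)"
  using J_endo by (simp add: quot_endo_def flip: qadd_coset[OF subspace_h])

lemma J_scale: "J ((c *\<^sub>R x) +o h) = qscale h c (J (x +o h))"
  using J_endo by (simp add: quot_endo_def flip: qscale_coset[OF subspace_h])

lemma J_inverse:
  assumes "J (x +o h) = (- y) +o h"
  shows "J (y +o h) = x +o h"
proof -
  have "J ((- y) +o h) = (- x) +o h"
    using J_square[of "x +o h"] assms by (simp add: qscale_coset[OF subspace_h])
  then show ?thesis
    using J_scale[of "-1" "- y"] by (simp add: qscale_coset[OF subspace_h])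
qed

definition holomorphic_part :: "('g \<times> 'g) set" where
  "holomorphic_part = cproj h -` plus_eigenspace h J"

text \<open>The eigenvector equation for \<open>a + i b\<close> consists of \<open>J a = - b\<close> and \<open>J b = a\<close>, of which the second
follows from the first.\<close>

lemma holomorphic_part_iff: "(x, y) \<in> holomorphic_part \<longleftrightarrow> J (x +o h) = (- y) +o h"
proof -
  have "cscale (qscale h) \<i> (x +o h, y +o h) = ((- y) +o h, x +o h)"
    by (simp add: cscale_def qscale_coset[OF subspace_h])
  then show ?thesis
    using J_inverse[of x y] by (auto simp: holomorphic_part_def cproj_def plus_eigenspace_def)
qed

lemma holomorphic_part_cover: obtains y where "(x, y) \<in> holomorphic_part"
proof -
  obtain z where "J (x +o h) = z +o h" by (rule J_coset)
  then have "(x, - z) \<in> holomorphic_part" by (simp add: holomorphic_part_iff)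
  then show thesis by (rule that)
qed

lemma holomorphic_part_rotate: "(x, y) \<in> holomorphic_part \<Longrightarrow> (y, - x) \<in> holomorphic_part"
  using J_inverse[of x y] by (simp add: holomorphic_part_iff)

lemma subspace_holomorphic_part: "subspace holomorphic_part"
proof (rule subspaceI)
  obtain y where "J (0 +o h) = y +o h" by (rule J_coset)
  then have "J (0 +o h) = 0 +o h"
    using J_scale[of 0 0] qscale_coset[OF subspace_h, of 0 y] by simp
  then show "0 \<in> holomorphic_part" by (simp add: zero_prod_def holomorphic_part_iff)
  fix z w c assume z: "z \<in> holomorphic_part"
  then show "c *\<^sub>R z \<in> holomorphic_part"
    by (cases z) (simp add: holomorphic_part_iff J_scale qscale_coset[OF subspace_h])
  assume "w \<in> holomorphic_part"
  then show "z + w \<in> holomorphic_part"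
    using z by (cases z; cases w) (simp add: holomorphic_part_iff J_add qadd_coset[OF subspace_h] add.commute)
qed

lemma real_in_holomorphic_part_iff: "(x, 0) \<in> holomorphic_part \<longleftrightarrow> x \<in> h"
proof
  assume x: "x \<in> h"
  have "(0, 0) \<in> holomorphic_part"
    using subspace_0[OF subspace_holomorphic_part] by (simp add: zero_prod_def)
  moreover have "x +o h = 0 +o h" using x coset_eq_iff[OF subspace_h, of x 0] by simp
  ultimately show "(x, 0) \<in> holomorphic_part" by (simp add: holomorphic_part_iff)
next
  assume "(x, 0) \<in> holomorphic_part"
  then have "(0, - x) \<in> holomorphic_part" by (rule holomorphic_part_rotate)
  moreover have "(0, 0) \<in> holomorphic_part"
    using subspace_0[OF subspace_holomorphic_part] by (simp add: zero_prod_def)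
  ultimately have "x +o h = 0 +o h" by (simp add: holomorphic_part_iff)
  then show "x \<in> h" using coset_eq_iff[OF subspace_h, of x 0] by simp
qed

lemma complex_subspace_holomorphic_part: "module.subspace (cscale scaleR) holomorphic_part"
proof -
  interpret vector_space "cscale scaleR :: complex \<Rightarrow> 'g \<times> 'g \<Rightarrow> 'g \<times> 'g"
    by unfold_locales (auto simp: cscale_def prod_eq_iff algebra_simps)
  have "cscale scaleR c z \<in> holomorphic_part" if "z \<in> holomorphic_part" for c z
  proof -
    obtain x y where z: "z = (x, y)" by (cases z)
    have "Re c *\<^sub>R (x, y) - Im c *\<^sub>R (y, - x) \<in> holomorphic_part"
      using that holomorphic_part_rotate[of x y]
        real_vector.subspace_diff[OF subspace_holomorphic_part]
        real_vector.subspace_scale[OF subspace_holomorphic_part] unfolding z by metis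
    then show ?thesis by (simp add: z cscale_def)
  qed
  then show ?thesis
    using real_vector.subspace_0[OF subspace_holomorphic_part]
      real_vector.subspace_add[OF subspace_holomorphic_part]
    by (simp add: subspace_def)
qed

end

locale complex_homogeneous_space = complex_quotient h J + lie_algebra scaleR br
  for h :: "'g::real_vector set" and J and br :: "'g \<Rightarrow> 'g \<Rightarrow> 'g" +
  assumes bracket_h: "\<And>x y. x \<in> h \<Longrightarrow> y \<in> h \<Longrightarrow> br x y \<in> h"
    and invariant: "\<And>x A. x \<in> h \<Longrightarrow> A \<in> quot h \<Longrightarrow> J (quot_ad br h x A) = quot_ad br h x (J A)"
    and integrable: "integrable_complex_structure br h J"
begin

sublocale c: lie_algebra "cscale scaleR :: complex \<Rightarrow> 'g \<times> 'g \<Rightarrow> 'g \<times> 'g" "cbracket br"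
  by (rule lie_algebra_complexification) (rule lie_algebra_axioms)

text \<open>For elements \<open>x - i x'\<close> and \<open>y - i y'\<close> with \<open>x'\<close>, \<open>y'\<close> over \<open>J x\<close>, \<open>J y\<close>, membership of the bracket says
that \<open>J\<close> maps the class of \<open>[x, y] - [x', y']\<close> to that of \<open>[x', y] + [x, y']\<close>. This is
\<open>J\<close> applied to the vanishing of the Nijenhuis tensor.\<close>

lemma lie_subalgebra_holomorphic_part: "c.lie_subalgebra holomorphic_part"
  unfolding c.lie_subalgebra_def
proof (intro conjI ballI complex_subspace_holomorphic_part)
  fix z w assume zw: "z \<in> holomorphic_part" "w \<in> holomorphic_part"
  obtain x x' y y' where z: "z = (x, - x')" and w: "w = (y, - y')"
    by (metis minus_minus surj_pair)
  have x: "x' +o h = J (x +o h)" and y: "y' +o h = J (y +o h)"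
    using zw by (simp_all add: z w holomorphic_part_iff)
  define a where "a = br x' y + br x y'"
  obtain c where c: "J (a +o h) = c +o h" by (rule J_coset)
  have "(br x y +o h) + J ((br x' y +o h) + (br x y' +o h)) + qscale h (- 1) (br x' y' +o h) = h"
    using integrable x y unfolding integrable_complex_structure_def by blast
  then have "(br x y + c + - br x' y') +o h = 0 +o h"
    using c by (simp add: qadd_coset[OF subspace_h] qscale_coset[OF subspace_h] flip: a_def)
  then have "br x y + c + - br x' y' \<in> h"
    using coset_eq_iff[OF subspace_h, of "br x y + c + - br x' y'" 0] by simp
  then have "(br x y - br x' y') +o h = (- c) +o h"
    by (simp add: coset_eq_iff[OF subspace_h] algebra_simps)
  moreover have "J ((- c) +o h) = a +o h"
  proof -
    have "J (c +o h) = (- a) +o h"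
      using J_square[of "a +o h"] c by (simp add: qscale_coset[OF subspace_h])
    then show ?thesis using J_scale[of "-1" c] by (simp add: qscale_coset[OF subspace_h])
  qed
  ultimately show "cbracket br z w \<in> holomorphic_part"
    by (simp add: z w cbracket_def holomorphic_part_iff bracket_simps a_def add.commute)
qed

text \<open>A real element that normalizes \<open>q\<close> also normalizes \<open>h\<close>, the set of real elements of \<open>q\<close>. For a real element of
the normalizer of \<open>h\<close>, commuting with \<open>J\<close> means preserving the graph that defines \<open>q\<close>.\<close>

lemma cembed_in_normalizer_iff:
  "cembed x \<in> c.normalizer holomorphic_part \<longleftrightarrow> x \<in> holomorphic_normalizer br h J"
proof
  assume "cembed x \<in> c.normalizer holomorphic_part"
  then have N: "(br x y, br x y') \<in> holomorphic_part" if "(y, y') \<in> holomorphic_part" for y y'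
    using that by (fastforce simp: c.normalizer_def cbracket_def cembed_def)
  have "br x y \<in> h" if "y \<in> h" for y
    using N[of y 0] that by (simp add: real_in_holomorphic_part_iff)
  then have x: "x \<in> normalizer h" by (simp add: normalizer_def)
  have "quot_ad br h x (J (y +o h)) = J (quot_ad br h x (y +o h))" for y
  proof -
    obtain y' where y': "(y, y') \<in> holomorphic_part" by (rule holomorphic_part_cover)
    then show ?thesis using N[OF y']
      by (simp add: holomorphic_part_iff quot_ad_coset[OF lie_algebra_axioms subspace_h x] bracket_simps)
  qed
  then show "x \<in> holomorphic_normalizer br h J"
    using x by (auto simp: holomorphic_normalizer_def quot_def)
next
  assume "x \<in> holomorphic_normalizer br h J"
  then have x: "x \<in> normalizer h"
    and comm: "quot_ad br h x (J (y +o h)) = J (quot_ad br h x (y +o h))" for y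
    by (auto simp: holomorphic_normalizer_def)
  have "(br x y, br x y') \<in> holomorphic_part" if "(y, y') \<in> holomorphic_part" for y y'
    using comm[of y] that
    by (simp add: holomorphic_part_iff quot_ad_coset[OF lie_algebra_axioms subspace_h x] bracket_simps)
  then show "cembed x \<in> c.normalizer holomorphic_part"
    by (auto simp: c.normalizer_def cbracket_def cembed_def)
qed

lemma isotropy_subset_holomorphic_normalizer: "h \<subseteq> holomorphic_normalizer br h J"
  using bracket_h invariant by (auto simp: holomorphic_normalizer_def normalizer_def)

lemma lie_subalgebra_normalizer_holomorphic_part: "c.lie_subalgebra (c.normalizer holomorphic_part)"
  by (rule c.lie_subalgebra_normalizer) (rule complex_subspace_holomorphic_part)

lemma holomorphic_part_subset_normalizer: "holomorphic_part \<subseteq> c.normalizer holomorphic_part"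
  using lie_subalgebra_holomorphic_part by (auto simp: c.lie_subalgebra_def c.normalizer_def)

lemma lie_subalgebra_holomorphic_normalizer: "lie_subalgebra (holomorphic_normalizer br h J)"
proof -
  let ?p = "c.normalizer holomorphic_part"
  have p: "c.subspace ?p" "\<And>z w. z \<in> ?p \<Longrightarrow> w \<in> ?p \<Longrightarrow> cbracket br z w \<in> ?p"
    using lie_subalgebra_normalizer_holomorphic_part by (auto simp: c.lie_subalgebra_def)
  have "cembed 0 \<in> ?p" using c.subspace_0[OF p(1)] by (simp add: cembed_def zero_prod_def)
  moreover have "cembed (x + y) \<in> ?p" if "cembed x \<in> ?p" "cembed y \<in> ?p" for x y
    using c.subspace_add[OF p(1) that] by (simp add: cembed_def)
  moreover have "cembed (a *\<^sub>R x) \<in> ?p" if "cembed x \<in> ?p" for a x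
    using c.subspace_scale[OF p(1) that, of "of_real a"] by (simp add: cembed_def cscale_def)
  moreover have "cembed (br x y) \<in> ?p" if "cembed x \<in> ?p" "cembed y \<in> ?p" for x y
    using p(2)[OF that] by (simp add: cembed_def cbracket_def)
  ultimately show ?thesis
    by (simp add: lie_subalgebra_def local.subspace_def cembed_in_normalizer_iff)
qed

text \<open>Subtracting from an element of the normalizer an element of \<open>q\<close> with the same imaginary part leaves a
real element of the normalizer, which by \<open>cembed_in_normalizer_iff\<close> splits along \<open>u\<close> and \<open>h \<subseteq> q\<close>.\<close>

lemma direct_sum_normalizer:
  assumes u: "direct_sum u h (holomorphic_normalizer br h J)"
  shows "direct_sum (cembed ` u) holomorphic_part (c.normalizer holomorphic_part)"
proof -
  let ?p = "c.normalizer holomorphic_part" and ?m = "holomorphic_normalizer br h J"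
  have su: "Real_Vector_Spaces.subspace u" and int: "u \<inter> h = {0}" and m: "?m = u + h"
    using u by (auto simp: direct_sum_def)
  have um: "u \<subseteq> ?m"
    using Real_Vector_Spaces.subspace_0[OF subspace_h] unfolding m
    by (force simp: set_plus_def)
  have p: "c.subspace ?p" using lie_subalgebra_normalizer_holomorphic_part by (simp add: c.lie_subalgebra_def)
  have "Real_Vector_Spaces.subspace (cembed ` u)"
    using su by (intro real_vector.subspaceI)
      (auto simp: cembed_def zero_prod_def image_iff dest: real_vector.subspace_0
        intro: real_vector.subspace_add real_vector.subspace_scale)
  moreover have "cembed ` u \<inter> holomorphic_part = {0}"
    using int real_in_holomorphic_part_iff real_vector.subspace_0[OF su]
      real_vector.subspace_0[OF subspace_holomorphic_part]
    by (auto simp: cembed_def zero_prod_def image_iff)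
  moreover have "?p \<subseteq> cembed ` u + holomorphic_part"
  proof
    fix z assume z: "z \<in> ?p"
    obtain x y where xy: "z = (x, y)" by (cases z)
    obtain w where w: "(y, w) \<in> holomorphic_part" by (rule holomorphic_part_cover)
    have "(- w, y) \<in> holomorphic_part"
      using holomorphic_part_rotate[OF holomorphic_part_rotate[OF holomorphic_part_rotate[OF w]]]
      by simp
    define x' where "x' = x + w"
    have "z = cembed x' + (- w, y)" by (simp add: xy x'_def cembed_def)
    moreover from this have "cembed x' = z - (- w, y)" by simp
    then have "cembed x' \<in> ?p"
      using z \<open>(- w, y) \<in> holomorphic_part\<close> holomorphic_part_subset_normalizer
        c.subspace_diff[OF p] by (metis subsetD)
    then obtain a b where ab: "a \<in> u" "b \<in> h" "x' = a + b"
      using m by (auto simp: cembed_in_normalizer_iff set_plus_def)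
    moreover have "(b, 0) + (- w, y) \<in> holomorphic_part"
      using ab(2) \<open>(- w, y) \<in> holomorphic_part\<close>
      by (intro real_vector.subspace_add[OF subspace_holomorphic_part])
        (simp_all add: real_in_holomorphic_part_iff)
    ultimately have "z = cembed a + ((b, 0) + (- w, y))" "cembed a \<in> cembed ` u"
        "(b, 0) + (- w, y) \<in> holomorphic_part"
      by (simp_all add: cembed_def)
    then show "z \<in> cembed ` u + holomorphic_part" by (metis set_plus_intro)
  qed
  moreover have "cembed ` u + holomorphic_part \<subseteq> ?p"
  proof
    fix z assume "z \<in> cembed ` u + holomorphic_part"
    then obtain a w where "a \<in> u" "w \<in> holomorphic_part" "z = cembed a + w"
      by (auto simp: set_plus_def)
    moreover from this have "cembed a \<in> ?p" using um cembed_in_normalizer_iff by blast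
    ultimately show "z \<in> ?p"
      using c.subspace_add[OF p] holomorphic_part_subset_normalizer by blast
  qed
  ultimately show ?thesis
    using subspace_holomorphic_part unfolding direct_sum_def by blast
qed

text \<open>By invariance of \<open>B\<close>, elements that normalize \<open>h\<close> preserve its orthogonal complement. Orthogonal
projection onto \<open>h\<close> is obtained from the hermitian projection onto the complexification of \<open>h\<close>.\<close>

lemma orthogonal_ideal_complement:
  fixes S :: "'g set" and B :: "'g \<Rightarrow> 'g \<Rightarrow> real"
  assumes fin: "finite S" "Real_Vector_Spaces.span S = UNIV" and B: "invariant_inner_product br B"
  defines "u \<equiv> {x \<in> holomorphic_normalizer br h J. \<forall>y\<in>h. B x y = 0}"
  shows "lie_subalgebra u" and "direct_sum u h (holomorphic_normalizer br h J)"
proof -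
  let ?m = "holomorphic_normalizer br h J"
  have bil: "bilinear B" and pos: "\<And>x. x \<noteq> 0 \<Longrightarrow> B x x > 0"
    and inv: "\<And>x y z. B (br x y) z + B y (br x z) = 0"
    using B by (auto simp: invariant_inner_product_def)
  have m: "lie_subalgebra ?m" by (rule lie_subalgebra_holomorphic_normalizer)
  then have sm: "subspace ?m" by (simp add: lie_subalgebra_def)
  have su: "subspace u"
    using sm unfolding u_def local.subspace_def
    by (auto simp: bilinear_ladd[OF bil] bilinear_lmul[OF bil] bilinear_lzero[OF bil])
  have "br x y \<in> u" if "x \<in> u" "y \<in> u" for x y
  proof -
    have "B (br x y) z = 0" if "z \<in> h" for z
    proof -
      have "br x z \<in> h" using \<open>x \<in> u\<close> that by (auto simp: u_def holomorphic_normalizer_def normalizer_def)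
      then show ?thesis using inv[of x y z] \<open>y \<in> u\<close> by (simp add: u_def)
    qed
    then show ?thesis using that m by (auto simp: u_def lie_subalgebra_def)
  qed
  then show "lie_subalgebra u" using su by (simp add: lie_subalgebra_def)
  obtain Basis where
    "compact_real_form (cscale scaleR) Basis (complexify_form B) (cbracket br) conjugate"
    using compact_real_form_complexification[OF lie_algebra_axioms fin B] .
  then interpret k: compact_real_form "cscale scaleR" Basis "complexify_form B" "cbracket br" conjugate .
  have below: "?m \<subseteq> u + h"
  proof
    fix x assume x: "x \<in> ?m"
    have "c.subspace (h \<times> h)"
    proof (rule c.subspaceI)
      note h = real_vector.subspace_0[OF subspace_h] real_vector.subspace_add[OF subspace_h]
        real_vector.subspace_diff[OF subspace_h] real_vector.subspace_scale[OF subspace_h]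
      show "0 \<in> h \<times> h" by (simp add: mem_Times_iff h)
      show "z + w \<in> h \<times> h" if "z \<in> h \<times> h" "w \<in> h \<times> h" for z w
        using that by (simp add: mem_Times_iff h)
      show "cscale scaleR a z \<in> h \<times> h" if "z \<in> h \<times> h" for a z
        using that by (simp add: mem_Times_iff cscale_def h)
    qed
    then obtain z w where zw: "(x, 0) = z + w" "z \<in> h \<times> h"
        "\<And>s. s \<in> h \<times> h \<Longrightarrow> complexify_form B w s = 0"
      using k.orthogonal_decomposition by metis
    have x_eq: "x = fst w + fst z" using zw(1) by (metis add.commute fst_add fst_conv)
    have "B (fst w) y = 0" if "y \<in> h" for y
    proof -
      have "complexify_form B w (y, 0) = 0"
        using zw(3) that real_vector.subspace_0[OF subspace_h] by simp
      then show ?thesis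
        by (simp add: complexify_form_def complex_eq_iff bilinear_rzero[OF bil])
    qed
    moreover have "fst w \<in> ?m"
    proof -
      have "fst w = x - fst z" using x_eq by simp
      moreover have "fst z \<in> ?m" using zw(2) isotropy_subset_holomorphic_normalizer by auto
      ultimately show ?thesis using sm x subspace_diff by metis
    qed
    ultimately have "fst w \<in> u" by (simp add: u_def)
    then show "x \<in> u + h" using x_eq zw(2) by (metis mem_Times_iff set_plus_intro)
  qed
  have above: "u + h \<subseteq> ?m"
    using subspace_add[OF sm] isotropy_subset_holomorphic_normalizer
    by (auto simp: set_plus_def u_def)
  have int: "u \<inter> h = {0}"
  proof -
    have "x = 0" if "x \<in> u" "x \<in> h" for x
      using that pos[of x] by (fastforce simp: u_def)
    then show ?thesis
      using subspace_0[OF su] real_vector.subspace_0[OF subspace_h] by auto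
  qed
  have "Real_Vector_Spaces.subspace u" using su unfolding subspace_raw_def .
  then show "direct_sum u h ?m"
    unfolding direct_sum_def using subspace_h int below above by blast
qed

end

section \<open>The normalizer of the holomorphic part\<close>

theorem theorem1p2:
  fixes br :: "'g::real_vector \<Rightarrow> 'g \<Rightarrow> 'g"
    and h m :: "'g set"
    and J :: "'g set \<Rightarrow> 'g set"
    and q p :: "('g \<times> 'g) set"
  assumes "lie_algebra scaleR br"
    and "\<exists>S :: 'g set. finite S \<and> span S = UNIV"
    and "\<exists>B. invariant_inner_product br B"
    and "lie_algebra.lie_subalgebra scaleR br h"
    and "even (dim (UNIV :: 'g set) - dim h)"
    and "invariant_complex_structure br h J"
    and "integrable_complex_structure br h J"
    and m_eq: "m = holomorphic_normalizer br h J"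
    and q_eq: "q = cproj h -` plus_eigenspace h J"
    and p_eq: "p = lie_algebra.normalizer (cbracket br) q"
  shows "lie_algebra.parabolic_subalgebra (cscale scaleR) (cbracket br) p \<and>
    (\<exists>u. lie_algebra.lie_subalgebra scaleR br u \<and> direct_sum u h m) \<and>
    (\<forall>u. lie_algebra.lie_subalgebra scaleR br u \<and> direct_sum u h m \<longrightarrow>
       direct_sum (cembed ` u) q p) \<and>
    p \<inter> range cembed = cembed ` m"
proof -
  interpret g: lie_algebra scaleR br by fact
  obtain S :: "'g set" where S: "finite S" "span S = UNIV" using assms(2) by blast
  obtain B where B: "invariant_inner_product br B" using assms(3) by blast
  interpret complex_homogeneous_space h J br
  proof
    show "subspace h"
      using assms(4) by (simp add: g.lie_subalgebra_def subspace_raw_def)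
    show "br x y \<in> h" if "x \<in> h" "y \<in> h" for x y
      using assms(4) that by (simp add: g.lie_subalgebra_def)
  qed (use assms(6,7) in \<open>auto simp: invariant_complex_structure_def\<close>)
  obtain Basis where
    "compact_real_form (cscale scaleR) Basis (complexify_form B) (cbracket br) conjugate"
    using compact_real_form_complexification[OF assms(1) S B] .
  then interpret k: compact_real_form "cscale scaleR" Basis "complexify_form B" "cbracket br" conjugate .
  have q: "q = holomorphic_part" by (simp add: q_eq holomorphic_part_def)
  have p: "p = c.normalizer holomorphic_part" by (simp add: p_eq q)
  have "c.parabolic_subalgebra p"
    unfolding p
  proof (rule k.parabolic_normalizer[OF lie_subalgebra_holomorphic_part])
    fix z :: "'g \<times> 'g" assume "conjugate z = z"
    then have "- snd z = snd z" by (metis conjugate_def snd_conv)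
    then have "snd z = 0" by (metis add_eq_0_iff scaleR_half_double scaleR_zero_right)
    moreover obtain y where "((1/2) *\<^sub>R fst z, y) \<in> holomorphic_part"
      by (rule holomorphic_part_cover)
    ultimately show "\<exists>w\<in>holomorphic_part. w + conjugate w = z"
      by (intro bexI[of _ "((1/2) *\<^sub>R fst z, y)"])
        (simp_all add: conjugate_def prod_eq_iff flip: scaleR_left_distrib)
  qed
  moreover have "\<exists>u. g.lie_subalgebra u \<and> direct_sum u h m"
    using orthogonal_ideal_complement[OF S B] unfolding m_eq by blast
  moreover have "direct_sum (cembed ` u) q p" if "direct_sum u h m" for u
    using direct_sum_normalizer[of u] that by (simp add: p q m_eq)
  moreover have "p \<inter> range cembed = cembed ` m"
  proof (intro equalityI subsetI)
    fix z assume "z \<in> p \<inter> range cembed"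
    then obtain x where "z = cembed x" "cembed x \<in> p" by blast
    then show "z \<in> cembed ` m" using cembed_in_normalizer_iff[of x] by (simp add: p m_eq)
  next
    fix z assume "z \<in> cembed ` m"
    then obtain x where "z = cembed x" "x \<in> m" by blast
    then show "z \<in> p \<inter> range cembed" using cembed_in_normalizer_iff[of x] by (simp add: p m_eq)
  qed
  ultimately show ?thesis by simp
qed

end
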